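(* Let $\sigma\ge 0$. (i) If $q<s+1$, then there exists $k_1>0$ depending only on $p,q,r,s,\sigma$ such that whenever $\frac{d_2}{d_1}\le k_1$, every positive smooth solution $(u,v)$ of the stationary system satisfies $u\le u^*$ and $v\le v^*$ in $\overline\Omega$. (ii) If $r<s+1$, then there exists $k_2>0$ depending only on $p,q,r,s,\sigma$ such that whenever $\frac{d_2}{d_1}\le k_2$, every positive smooth solution $(u,v)$ of the stationary system satisfies $u\ge u^*$ and $v\ge v^*$ in $\overline\Omega$. (iii) If $\max\{q,r\}<s+1$, then whenever $\frac{d_2}{d_1}\le k=\min\{k_1,k_2\}$ (with $k_1,k_2$ from (i) and (ii)), every positive smooth solution satisfies $(u,v)\equiv(u^*,v^* )$.
   Context: $\Omega\subset\mathbb{R}^n$, $n\ge1$, is a bounded smooth domain with unit outer normal $\nu$ on $\partial\Omega$; $d_1,d_2>0$; $\sigma\ge0$ is a constant; $p,q,r,s\ge0$ satisfy $0<\frac{p-1}{r}<\frac{q}{s+1}$. The stationary system is $$d_1\Delta u-u+\frac{u^p}{v^q}+\sigma=0,\quad d_2\Delta v-v+\frac{u^r}{v^s}=0\ \text{ in }\Omega,\qquad \frac{\partial u}{\partial\nu}=\frac{\partial v}{\partial\nu}=0\ \text{ on }\partial\Omega.$$ A positive smooth solution is a pair $u,v\in C^\infty(\overline\Omega)$ with $u,v>0$ in $\overline\Omega$ solving it. $(u^*,v^* )$ denotes the unique constant positive solution of the stationary system. *)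

theory Defs
  imports "HOL-Analysis.Analysis"
begin

text \<open>
  The constants of the theorem must not depend on the dimension, so the dimension has to be a
  natural number that can be quantified inside a formula. Therefore R^n is the library space
  \<^term>\<open>Euclidean_space n\<close>: the maps \<open>x :: nat \<Rightarrow> real\<close> with \<open>x i = 0\<close> for \<open>i \<ge> n\<close>, whose
  coordinates are \<open>x 0, \<dots>, x (n - 1)\<close>.
\<close>

definition partial_deriv :: "nat \<Rightarrow> ((nat \<Rightarrow> real) \<Rightarrow> real) \<Rightarrow> (nat \<Rightarrow> real) \<Rightarrow> real" where
  "partial_deriv i f x = deriv (\<lambda>t. f (x(i := t))) (x i)"

primrec iter_partial :: "nat list \<Rightarrow> ((nat \<Rightarrow> real) \<Rightarrow> real) \<Rightarrow> (nat \<Rightarrow> real) \<Rightarrow> real" where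
  "iter_partial [] f = f"
| "iter_partial (i # is) f = partial_deriv i (iter_partial is f)"

definition laplacian :: "nat \<Rightarrow> ((nat \<Rightarrow> real) \<Rightarrow> real) \<Rightarrow> (nat \<Rightarrow> real) \<Rightarrow> real" where
  "laplacian n f x = (\<Sum>i<n. iter_partial [i, i] f x)"

text \<open>\<open>C\<^sup>\<infinity>(U)\<close> for an open set \<open>U\<close>. The values of \<open>f\<close> outside \<open>U\<close> are irrelevant.\<close>

definition smooth_on :: "nat \<Rightarrow> (nat \<Rightarrow> real) set \<Rightarrow> ((nat \<Rightarrow> real) \<Rightarrow> real) \<Rightarrow> bool" where
  "smooth_on n U f \<longleftrightarrow>
     (\<forall>is. set is \<subseteq> {..<n} \<longrightarrow>
        continuous_map (subtopology (Euclidean_space n) U) euclideanreal (iter_partial is f) \<and>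
        (\<forall>i<n. \<forall>x\<in>U. (\<lambda>t. iter_partial is f (x(i := t))) field_differentiable at (x i)))"

text \<open>
  \<open>C\<^sup>\<infinity>\<close> up to the boundary: \<open>f\<close> is continuous on the closure of the open set \<open>\<Omega>\<close>, smooth in \<open>\<Omega>\<close>,
  and each of its partial derivatives of any order extends continuously to the closure.
\<close>

definition smooth_on_closure :: "nat \<Rightarrow> (nat \<Rightarrow> real) set \<Rightarrow> ((nat \<Rightarrow> real) \<Rightarrow> real) \<Rightarrow> bool" where
  "smooth_on_closure n \<Omega> f \<longleftrightarrow>
     smooth_on n \<Omega> f \<and>
     continuous_map (subtopology (Euclidean_space n) (Euclidean_space n closure_of \<Omega>)) euclideanreal f \<and>
     (\<forall>is. set is \<subseteq> {..<n} \<longrightarrow>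
        (\<exists>g. continuous_map (subtopology (Euclidean_space n) (Euclidean_space n closure_of \<Omega>))
               euclideanreal g \<and>
             (\<forall>x\<in>\<Omega>. g x = iter_partial is f x)))"

text \<open>
  Near the boundary point \<open>x\<close>, the set \<open>\<Omega>\<close> is the sublevel set \<open>\<rho> < 0\<close> of a smooth function with
  nonvanishing gradient; \<open>\<Omega>\<close> then lies on one side of its boundary \<open>\<rho> = 0\<close> and the outward normal
  direction is that of the gradient of \<open>\<rho>\<close>.
\<close>

definition local_defining_function ::
  "nat \<Rightarrow> (nat \<Rightarrow> real) set \<Rightarrow> (nat \<Rightarrow> real) \<Rightarrow> (nat \<Rightarrow> real) set \<Rightarrow> ((nat \<Rightarrow> real) \<Rightarrow> real) \<Rightarrow> bool" where
  "local_defining_function n \<Omega> x U \<rho> \<longleftrightarrow>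
     openin (Euclidean_space n) U \<and> x \<in> U \<and> smooth_on n U \<rho> \<and>
     (\<forall>y\<in>U. \<exists>i<n. partial_deriv i \<rho> y \<noteq> 0) \<and>
     \<Omega> \<inter> U = {y \<in> U. \<rho> y < 0}"

text \<open>
  Boundedness is stated with coordinates because the type class metric on \<open>nat \<Rightarrow> real\<close> is a bounded
  metric for the product topology, so that every set is \<^const>\<open>bounded\<close>.
\<close>

definition bounded_smooth_domain :: "nat \<Rightarrow> (nat \<Rightarrow> real) set \<Rightarrow> bool" where
  "bounded_smooth_domain n \<Omega> \<longleftrightarrow>
     \<Omega> \<noteq> {} \<and> openin (Euclidean_space n) \<Omega> \<and> connectedin (Euclidean_space n) \<Omega> \<and>
     (\<exists>M. \<forall>x\<in>\<Omega>. \<forall>i<n. \<bar>x i\<bar> \<le> M) \<and>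
     (\<forall>x \<in> Euclidean_space n frontier_of \<Omega>. \<exists>U \<rho>. local_defining_function n \<Omega> x U \<rho>)"

definition outer_unit_normal :: "nat \<Rightarrow> (nat \<Rightarrow> real) set \<Rightarrow> (nat \<Rightarrow> real) \<Rightarrow> (nat \<Rightarrow> real) \<Rightarrow> bool" where
  "outer_unit_normal n \<Omega> x \<nu> \<longleftrightarrow>
     (\<exists>U \<rho>. local_defining_function n \<Omega> x U \<rho> \<and>
        \<nu> = (\<lambda>i. if i < n then partial_deriv i \<rho> x / sqrt (\<Sum>j<n. (partial_deriv j \<rho> x)\<^sup>2) else 0))"

text \<open>
  At a boundary point the gradient is the continuous extension of the gradient from inside \<open>\<Omega>\<close>, so
  the normal derivative at \<open>x\<close> is the limit of \<open>\<nabla>f(y) \<bullet> \<nu>(x)\<close> as \<open>y\<close> tends to \<open>x\<close> within \<open>\<Omega>\<close>.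
\<close>

definition has_normal_derivative ::
  "nat \<Rightarrow> (nat \<Rightarrow> real) set \<Rightarrow> ((nat \<Rightarrow> real) \<Rightarrow> real) \<Rightarrow> (nat \<Rightarrow> real) \<Rightarrow> (nat \<Rightarrow> real) \<Rightarrow> real \<Rightarrow> bool" where
  "has_normal_derivative n \<Omega> f x \<nu> D \<longleftrightarrow>
     ((\<lambda>y. \<Sum>i<n. partial_deriv i f y * \<nu> i) \<longlongrightarrow> D) (atin_within (Euclidean_space n) x \<Omega>)"

definition neumann_condition :: "nat \<Rightarrow> (nat \<Rightarrow> real) set \<Rightarrow> ((nat \<Rightarrow> real) \<Rightarrow> real) \<Rightarrow> bool" where
  "neumann_condition n \<Omega> f \<longleftrightarrow>
     (\<forall>x \<in> Euclidean_space n frontier_of \<Omega>. \<forall>\<nu>.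
        outer_unit_normal n \<Omega> x \<nu> \<longrightarrow> has_normal_derivative n \<Omega> f x \<nu> 0)"

definition positive_smooth_solution ::
  "nat \<Rightarrow> (nat \<Rightarrow> real) set \<Rightarrow> real \<Rightarrow> real \<Rightarrow> real \<Rightarrow> real \<Rightarrow> real \<Rightarrow> real \<Rightarrow> real \<Rightarrow>
   ((nat \<Rightarrow> real) \<Rightarrow> real) \<Rightarrow> ((nat \<Rightarrow> real) \<Rightarrow> real) \<Rightarrow> bool" where
  "positive_smooth_solution n \<Omega> d1 d2 p q r s \<sigma> u v \<longleftrightarrow>
     smooth_on_closure n \<Omega> u \<and> smooth_on_closure n \<Omega> v \<and>
     (\<forall>x \<in> Euclidean_space n closure_of \<Omega>. u x > 0 \<and> v x > 0) \<and>
     (\<forall>x\<in>\<Omega>. d1 * laplacian n u x - u x + u x powr p / v x powr q + \<sigma> = 0) \<and>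
     (\<forall>x\<in>\<Omega>. d2 * laplacian n v x - v x + u x powr r / v x powr s = 0) \<and>
     neumann_condition n \<Omega> u \<and> neumann_condition n \<Omega> v"

text \<open>The pair of values \<open>(u\<^sup>*, v\<^sup>*)\<close>.\<close>

definition constant_solution ::
  "nat \<Rightarrow> (nat \<Rightarrow> real) set \<Rightarrow> real \<Rightarrow> real \<Rightarrow> real \<Rightarrow> real \<Rightarrow> real \<Rightarrow> real \<Rightarrow> real \<Rightarrow> real \<times> real" where
  "constant_solution n \<Omega> d1 d2 p q r s \<sigma> =
     (THE c. positive_smooth_solution n \<Omega> d1 d2 p q r s \<sigma> (\<lambda>_. fst c) (\<lambda>_. snd c))"

end

theory Submission
  imports Defs
begin

text \<open>
  Write \<open>\<theta> = d2 / d1\<close>, \<open>a = q / (s + 1)\<close>, \<open>b = q r / (s + 1) - (p - 1)\<close>, and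
  \<open>X = u\<^sup>r / v\<^bsup>s+1\<^esup>\<close>, \<open>Y = u\<^bsup>p-1\<^esup> / v\<^sup>q + \<sigma> / u = X\<^sup>a u\<^bsup>-b\<^esup> + \<sigma> / u\<close>. The system reads
  \<open>d1 \<Delta>u = u (1 - Y)\<close>, \<open>d2 \<Delta>v = v (1 - X)\<close>. The hypothesis on the exponents is \<open>b > 0\<close>; hence
  \<open>x\<^bsup>-b\<^esup> + \<sigma> / x\<close> is strictly decreasing, and the constant solution is the unique pair with \<open>X = 1\<close> and
  \<open>Y = 1\<close>.

  For the upper bound let \<open>U\<close> be the maximum of \<open>u\<close>, attained at \<open>x0\<close>, and suppose that it exceeds \<open>u\<^sup>*\<close>. There
  \<open>Y \<ge> 1\<close>, whereas \<open>U\<^bsup>-b\<^esup> + \<sigma> / U < 1\<close>, so \<open>X\<close> must be at least the number \<open>A > 1\<close> with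
  \<open>A\<^sup>a U\<^bsup>-b\<^esup> + \<sigma> / U = 1\<close>: near \<open>x0\<close> the slowly diffusing component \<open>v\<close> is too small for the value of \<open>u\<close>. To
  exploit this, pass to the minimum \<open>x1\<close> of \<open>v / u\<^sup>B\<close> for a large \<open>B\<close>. If \<open>l\<close> is the minimal value, then
  \<open>v - l u\<^sup>B\<close> has a minimum at \<open>x1\<close>, and since \<open>B \<ge> 1\<close> the gradient term in its Laplacian is nonpositive.
  The result is \<open>X - 1 \<le> B \<theta> (Y - 1)\<close> at \<open>x1\<close>. With \<open>u(x1) = t U\<close>, minimality gives
  \<open>X(x1) \<ge> A t\<^bsup>-e\<^esup>\<close>, where \<open>e = B (s + 1) - r\<close>. As \<open>q < s + 1\<close>, that is \<open>a < 1\<close>, a large \<open>B\<close> makes all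
  powers of \<open>1 / t\<close> in \<open>Y\<close> small enough that \<open>Y \<le> X / A\<close>. Then \<open>Y - 1 < X - 1\<close> with \<open>X > 1\<close>, which is impossible
  when \<open>B \<theta> \<le> 1\<close>. So \<open>k1 = 1 / B\<close>, and \<open>B\<close> depends on the exponents only.

  The lower bound compares the minimum of \<open>u\<close> with the maximum of \<open>v / u\<close>; here \<open>B = 1\<close> and
  \<open>e = s + 1 - r > 0\<close>. One gets \<open>1 - X \<le> \<theta> (1 - Y)\<close> and \<open>Y \<ge> (X / A)\<^sup>m\<close> with \<open>A < 1\<close>, and Bernoulli's
  inequality yields a contradiction when \<open>\<theta> m \<le> 1\<close>. So \<open>k2 = 1 / m\<close>. In both cases the bound for \<open>v\<close> follows from
  the second equation at the extremum of \<open>v\<close>, and the two bounds together give the third claim.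

  The extrema may lie on the boundary. That the same inequalities hold there is
  \<open>neumann_maximum_principle\<close>, a version of Hopf's lemma for functions whose Laplacian has a continuous
  lower bound up to the boundary. It is applied only to the functions \<open>\<alpha> u\<^sup>B + \<beta> v\<close>
  (\<open>extremum_of_power_combination\<close>); everything else is real arithmetic
  (\<open>production_gap_above_equilibrium\<close>, \<open>production_gap_below_equilibrium\<close>).
\<close>

section \<open>Topology of coordinate space\<close>

text \<open>
  The sets and limits of \<open>Euclidean_space n\<close> are those of the closed subspace \<open>coord_space n\<close> in the
  product topology on \<open>nat \<Rightarrow> real\<close>, for which continuity, closures and compactness are available
  in their type class form.
\<close>

abbreviation coord_space :: "nat \<Rightarrow> (nat \<Rightarrow> real) set" where
  "coord_space n \<equiv> {x. \<forall>i\<ge>n. x i = 0}"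

text \<open>
  Squared because only the square is a polynomial in the coordinates: its second partial derivatives
  are constant, as the barrier of the maximum principle requires.
\<close>

definition sq_dist :: "nat \<Rightarrow> (nat \<Rightarrow> real) \<Rightarrow> (nat \<Rightarrow> real) \<Rightarrow> real" where
  "sq_dist n x y = (\<Sum>i<n. (x i - y i)\<^sup>2)"

lemma sq_dist_nonneg [simp]: "0 \<le> sq_dist n x y"
  by (simp add: sq_dist_def sum_nonneg)

lemma sq_dist_self [simp]: "sq_dist n x x = 0"
  by (simp add: sq_dist_def)

lemma Euclidean_space_eq_top_of_set: "Euclidean_space n = top_of_set (coord_space n)"
  by (simp add: Euclidean_space_def euclidean_product_topology)

lemma closed_coord_space: "closed (coord_space n)"
  using closedin_Euclidean_space[of n]
  by (simp add: euclidean_product_topology topspace_Euclidean_space)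

lemma closure_of_Euclidean_space:
  assumes "S \<subseteq> coord_space n"
  shows "Euclidean_space n closure_of S = closure S"
proof -
  have "closure S \<subseteq> coord_space n"
    using assms closed_coord_space closure_minimal by blast
  moreover have "coord_space n \<inter> S = S" using assms by blast
  ultimately show ?thesis
    by (auto simp: Euclidean_space_eq_top_of_set closure_of_subtopology)
qed

lemma continuous_map_Euclidean_subspace:
  assumes "S \<subseteq> coord_space n"
  shows "continuous_map (subtopology (Euclidean_space n) S) euclideanreal f \<longleftrightarrow> continuous_on S f"
proof -
  have "coord_space n \<inter> S = S" using assms by blast
  then show ?thesis
    by (simp add: Euclidean_space_eq_top_of_set subtopology_subtopology)
qed

lemma openin_Euclidean_space_iff:
  "openin (Euclidean_space n) W \<longleftrightarrow> (\<exists>T. open T \<and> W = coord_space n \<inter> T)"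
  by (simp add: Euclidean_space_eq_top_of_set openin_open)

lemma atin_within_Euclidean_space:
  assumes "x \<in> coord_space n" "S \<subseteq> coord_space n"
  shows "atin_within (Euclidean_space n) x S = at x within S"
proof (rule filter_eqI)
  fix P
  have "(\<exists>T. openin (Euclidean_space n) T \<and> x \<in> T \<and> (\<forall>y\<in>T. y \<in> S \<and> y \<noteq> x \<longrightarrow> P y)) \<longleftrightarrow>
      (\<exists>T. open T \<and> x \<in> T \<and> (\<forall>y\<in>T. y \<noteq> x \<longrightarrow> y \<in> S \<longrightarrow> P y))" (is "?L \<longleftrightarrow> ?R")
  proof
    assume ?L
    then obtain W where W: "openin (Euclidean_space n) W" "x \<in> W" "\<And>y. y \<in> W \<Longrightarrow> y \<in> S \<and> y \<noteq> x \<Longrightarrow> P y"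
      by (elim exE conjE) simp
    then obtain T where T: "open T" "W = coord_space n \<inter> T"
      using openin_Euclidean_space_iff[of n W] by (elim iffD1[elim_format] exE conjE) simp_all
    have "P y" if "y \<in> T" "y \<noteq> x" "y \<in> S" for y
      using that W(3)[of y] T(2) assms(2) by (simp add: subset_iff)
    moreover have "x \<in> T" using W(2) T(2) by simp
    ultimately show ?R using T(1) by (intro exI[of _ T]) simp
  next
    assume ?R
    then obtain T where T: "open T" "x \<in> T" "\<And>y. y \<in> T \<Longrightarrow> y \<noteq> x \<Longrightarrow> y \<in> S \<Longrightarrow> P y"
      by (elim exE conjE) simp
    have "openin (Euclidean_space n) (coord_space n \<inter> T)"
      unfolding openin_Euclidean_space_iff using T(1) by (intro exI[of _ T]) simp
    then show ?L
      using T assms(1) by (intro exI[of _ "coord_space n \<inter> T"]) simp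
  qed
  then show "eventually P (atin_within (Euclidean_space n) x S) \<longleftrightarrow> eventually P (at x within S)"
    using assms(1)
    by (simp only: eventually_atin_within eventually_at_topological topspace_Euclidean_space
        not_not simp_thms)
qed

lemma tendsto_coordinatewise:
  fixes f :: "'a \<Rightarrow> nat \<Rightarrow> real"
  assumes "\<And>i. ((\<lambda>a. f a i) \<longlongrightarrow> l i) F"
  shows "(f \<longlongrightarrow> l) F"
proof -
  have "limitin (product_topology (\<lambda>i. euclidean) UNIV) f l F"
    using assms by (subst limitin_componentwise) auto
  then show ?thesis
    by (simp add: euclidean_product_topology)
qed

text \<open>
  On \<open>coord_space n\<close> only finitely many coordinates vary, so convergence of \<open>sq_dist n\<close> to \<open>0\<close> is
  convergence of every coordinate, that is, convergence in the product topology.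
\<close>

lemma open_contains_sq_ball:
  assumes T: "open T" "x \<in> T" and x: "x \<in> coord_space n"
  shows "\<exists>\<delta>>0. \<forall>y\<in>coord_space n. sq_dist n y x \<le> \<delta> \<longrightarrow> y \<in> T"
proof (rule ccontr)
  assume neg: "\<not> ?thesis"
  have "\<forall>k. \<exists>y. y \<in> coord_space n \<and> sq_dist n y x \<le> inverse (real (Suc k)) \<and> y \<notin> T"
  proof
    fix k :: nat
    have "inverse (real (Suc k)) > 0" by simp
    with neg show "\<exists>y. y \<in> coord_space n \<and> sq_dist n y x \<le> inverse (real (Suc k)) \<and> y \<notin> T"
      by blast
  qed
  from choice[OF this] obtain y where y': "\<forall>k. y k \<in> coord_space n \<and>
      sq_dist n (y k) x \<le> inverse (real (Suc k)) \<and> y k \<notin> T" ..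
  then have y: "\<And>k. y k \<in> coord_space n" "\<And>k. y k \<notin> T"
      "\<And>k. sq_dist n (y k) x \<le> inverse (real (Suc k))"
    by simp_all
  have "(\<lambda>k. y k i) \<longlonglongrightarrow> x i" for i
  proof (cases "i < n")
    case True
    have "(y k i - x i)\<^sup>2 \<le> inverse (real (Suc k))" for k
    proof -
      have "(y k i - x i)\<^sup>2 \<le> sq_dist n (y k) x"
        unfolding sq_dist_def using True by (intro member_le_sum) auto
      with y(3)[of k] show ?thesis by linarith
    qed
    then have "(\<lambda>k. (y k i - x i)\<^sup>2) \<longlonglongrightarrow> 0"
      by (intro tendsto_sandwich[OF _ _ tendsto_const LIMSEQ_inverse_real_of_nat]) auto
    then have "(\<lambda>k. sqrt ((y k i - x i)\<^sup>2)) \<longlonglongrightarrow> sqrt 0"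
      by (rule tendsto_real_sqrt)
    then have "(\<lambda>k. \<bar>y k i - x i\<bar>) \<longlonglongrightarrow> 0" by simp
    then have "(\<lambda>k. y k i - x i) \<longlonglongrightarrow> 0" by (simp only: tendsto_rabs_zero_iff)
    then show ?thesis by (rule LIM_zero_cancel)
  next
    case False
    then have "y k i = x i" for k using y(1)[of k] x by auto
    then show ?thesis by simp
  qed
  then have "y \<longlonglongrightarrow> x" by (rule tendsto_coordinatewise)
  then have "eventually (\<lambda>k. y k \<in> T) sequentially"
    using T topological_tendstoD by blast
  with y(2) show False by simp
qed

lemma eventually_at_within_sq_ball:
  assumes "eventually P (at x within S)" "S \<subseteq> coord_space n" "x \<in> coord_space n"
  shows "\<exists>\<delta>>0. \<forall>y\<in>S. sq_dist n y x \<le> \<delta> \<and> y \<noteq> x \<longrightarrow> P y"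
proof -
  obtain T where T: "open T" "x \<in> T" "\<forall>y\<in>T. y \<noteq> x \<longrightarrow> y \<in> S \<longrightarrow> P y"
    using assms(1) unfolding eventually_at_topological by blast
  obtain \<delta> where "\<delta> > 0" "\<forall>y\<in>coord_space n. sq_dist n y x \<le> \<delta> \<longrightarrow> y \<in> T"
    using open_contains_sq_ball[OF T(1,2) assms(3)] by blast
  then show ?thesis using T(3) assms(2) by blast
qed

lemma continuous_on_sq_ball:
  fixes g :: "(nat \<Rightarrow> real) \<Rightarrow> real"
  assumes "continuous_on S g" "x \<in> S" "S \<subseteq> coord_space n" "0 < e"
  shows "\<exists>\<delta>>0. \<forall>y\<in>S. sq_dist n y x \<le> \<delta> \<longrightarrow> \<bar>g y - g x\<bar> < e"
proof -
  have "(g \<longlongrightarrow> g x) (at x within S)" using assms by (simp add: continuous_on)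
  then have "eventually (\<lambda>y. \<bar>g y - g x\<bar> < e) (at x within S)"
    using tendstoD[of g "g x" _ e] \<open>0 < e\<close> by (simp add: dist_real_def)
  moreover have "x \<in> coord_space n" using assms by blast
  ultimately obtain \<delta> where "\<delta> > 0"
    "\<forall>y\<in>S. sq_dist n y x \<le> \<delta> \<and> y \<noteq> x \<longrightarrow> \<bar>g y - g x\<bar> < e"
    using eventually_at_within_sq_ball[OF _ \<open>S \<subseteq> coord_space n\<close>] by blast
  then show ?thesis using \<open>0 < e\<close> by (metis abs_zero diff_self)
qed

lemma continuous_on_sq_dist: "continuous_on S (\<lambda>y. sq_dist n y x)"
  unfolding sq_dist_def
  by (intro continuous_intros continuous_on_subset[OF continuous_on_product_coordinates]) auto

lemma compact_closure_of_coord_bounded: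
  assumes "S \<subseteq> coord_space n" "\<forall>x\<in>S. \<forall>i<n. \<bar>x i\<bar> \<le> M"
  shows "compact (closure S)"
proof -
  define B where "B = PiE UNIV (\<lambda>i::nat. if i < n then {-M..M} else {0::real})"
  have "compactin (product_topology (\<lambda>i. euclidean) UNIV) B"
    unfolding B_def by (subst compactin_PiE) auto
  then have "compact B" by (simp add: euclidean_product_topology)
  moreover have "S \<subseteq> B"
    using assms by (force simp: B_def PiE_def Pi_def abs_le_iff)
  ultimately have "closure S \<subseteq> B"
    by (simp add: closure_minimal compact_imp_closed)
  then have "B \<inter> closure S = closure S" by blast
  with compact_Int_closed[OF \<open>compact B\<close> closed_closure[of S]] show ?thesis by simp
qed

section \<open>Coordinatewise calculus\<close>

lemma second_derivative_nonpos_at_local_max: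
  fixes h h1 :: "real \<Rightarrow> real"
  assumes "\<delta> > 0" and der: "\<And>t. \<bar>t - a\<bar> < \<delta> \<Longrightarrow> (h has_real_derivative h1 t) (at t)"
    and der2: "(h1 has_real_derivative h2) (at a)"
    and max: "\<And>t. \<bar>t - a\<bar> < \<delta> \<Longrightarrow> h t \<le> h a"
  shows "h2 \<le> 0"
proof (rule ccontr)
  assume "\<not> h2 \<le> 0"
  then obtain d where d: "d > 0" "\<forall>t>0. t < d \<longrightarrow> h1 a < h1 (a + t)"
    using DERIV_pos_inc_right[OF der2] by auto
  have "h1 a = 0"
    using DERIV_local_max[of h "h1 a" a \<delta>] der[of a] max \<open>\<delta> > 0\<close> by (auto simp: abs_minus_commute)
  define e where "e = min d \<delta> / 2"
  have e: "e > 0" "e < d" "e < \<delta>" using d \<open>\<delta> > 0\<close> by (auto simp: e_def min_def)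
  have "\<exists>z. a < z \<and> z < a + e \<and> h (a + e) - h a = (a + e - a) * h1 z"
    using e by (intro MVT2 der) auto
  then obtain z where z: "a < z" "z < a + e" "h (a + e) - h a = e * h1 z" by auto
  have "h1 z > 0" using d(2)[rule_format, of "z - a"] z e \<open>h1 a = 0\<close> by auto
  then have "h (a + e) > h a" using z e by (metis diff_gt_0_iff_gt mult_pos_pos)
  with max[of "a + e"] e show False by auto
qed

text \<open>
  The chain rule along a line, from coordinatewise differentiability with continuous partial
  derivatives. The increment is split into \<open>n\<close> increments parallel to the axes; the mean value theorem
  turns each of them into a value of a partial derivative at a point close to \<open>x\<close>. The maximum
  principle uses it both for the defining function and for the function that attains its maximum.
\<close>

lemma directional_derivative_of_continuous_partials:
  fixes f :: "(nat \<Rightarrow> real) \<Rightarrow> real"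
  assumes W: "openin (Euclidean_space n) W" and x: "x \<in> W"
    and der: "\<And>y i. y \<in> W \<Longrightarrow> i < n \<Longrightarrow> ((\<lambda>t. f (y(i := t))) has_real_derivative df i y) (at (y i))"
    and cont: "\<And>i. i < n \<Longrightarrow> continuous_on W (df i)"
    and d: "d \<in> coord_space n"
  shows "((\<lambda>t. f (\<lambda>i. x i + t * d i)) has_real_derivative (\<Sum>i<n. df i x * d i)) (at 0)"
proof -
  have WE: "W \<subseteq> coord_space n" using W by (auto simp: openin_Euclidean_space_iff)
  have xE: "x \<in> coord_space n" using x WE by blast
  have line_x: "(\<lambda>i. x i + 0 * d i) = x" by simp
  define S where "S = (\<Sum>i<n. \<bar>d i\<bar>)"
  have S: "0 \<le> S" by (simp add: S_def sum_nonneg)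
  define D where "D = (\<Sum>i<n. df i x * d i)"
  have main: "\<exists>\<tau>>0. \<forall>t. \<bar>t\<bar> < \<tau> \<longrightarrow> \<bar>f (\<lambda>i. x i + t * d i) - f x - t * D\<bar> \<le> \<epsilon> * S * \<bar>t\<bar>"
    if "\<epsilon> > 0" for \<epsilon>
  proof -
    have "\<exists>T. open T \<and> x \<in> T \<and> (\<forall>y\<in>T. y \<in> coord_space n \<longrightarrow> y \<in> W)"
      using W x by (auto simp: openin_Euclidean_space_iff)
    then have evW: "eventually (\<lambda>y. y \<in> W) (at x within coord_space n)"
      unfolding eventually_at_topological by blast
    have evf: "eventually (\<lambda>y. \<bar>df i y - df i x\<bar> < \<epsilon>) (at x within W)" if "i < n" for i
    proof -
      have "(df i \<longlongrightarrow> df i x) (at x within W)" using cont[OF that] x by (simp add: continuous_on)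
      from tendstoD[OF this \<open>\<epsilon> > 0\<close>] show ?thesis by (simp add: dist_real_def)
    qed
    then have "eventually (\<lambda>y. \<forall>i\<in>{..<n}. \<bar>df i y - df i x\<bar> < \<epsilon>) (at x within W)"
      by (intro eventually_ball_finite) auto
    from eventually_at_within_sq_ball[OF this WE xE] obtain \<delta>1
      where \<delta>1: "\<delta>1 > 0" "\<forall>y\<in>W. sq_dist n y x \<le> \<delta>1 \<and> y \<noteq> x \<longrightarrow> (\<forall>i\<in>{..<n}. \<bar>df i y - df i x\<bar> < \<epsilon>)"
      by blast
    from eventually_at_within_sq_ball[OF evW _ xE] obtain \<delta>2
      where \<delta>2: "\<delta>2 > 0" "\<forall>y\<in>coord_space n. sq_dist n y x \<le> \<delta>2 \<and> y \<noteq> x \<longrightarrow> y \<in> W"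
      by blast
    define \<delta> where "\<delta> = min \<delta>1 \<delta>2"
    have nbd: "y \<in> W \<and> (\<forall>i<n. \<bar>df i y - df i x\<bar> < \<epsilon>)"
      if "y \<in> coord_space n" "sq_dist n y x \<le> \<delta>" for y
    proof (cases "y = x")
      case True then show ?thesis using x \<open>\<epsilon> > 0\<close> by auto
    next
      case False
      then have "y \<in> W" using \<delta>2(2) that unfolding \<delta>_def by auto
      then show ?thesis using \<delta>1(2) that False unfolding \<delta>_def by auto
    qed
    have \<delta>: "\<delta> > 0" using \<delta>1 \<delta>2 by (simp add: \<delta>_def)
    define Q where "Q = (\<Sum>i<n. (d i)\<^sup>2)"
    have Q: "0 \<le> Q" by (simp add: Q_def sum_nonneg)
    \<comment> \<open>For these \<open>t\<close> the whole box spanned by \<open>x\<close> and \<open>x + t d\<close> lies in the \<open>\<delta>\<close>-neighbourhood.\<close>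
    define \<tau> where "\<tau> = min 1 (\<delta> / (Q + 1))"
    have \<tau>: "\<tau> > 0" using \<delta> Q by (simp add: \<tau>_def)
    have "\<bar>f (\<lambda>i. x i + t * d i) - f x - t * D\<bar> \<le> \<epsilon> * S * \<bar>t\<bar>" if t: "\<bar>t\<bar> < \<tau>" for t
    proof -
      \<comment> \<open>The path from \<open>x\<close> to \<open>x + t d\<close> that changes one coordinate after the other.\<close>
      define P where "P k = (\<lambda>i. if i < k then x i + t * d i else x i)" for k :: nat
      have tQ: "t\<^sup>2 * Q \<le> \<delta>"
      proof -
        have "t\<^sup>2 \<le> \<bar>t\<bar>" using t unfolding \<tau>_def
          by (metis abs_ge_zero less_eq_real_def min_less_iff_conj mult_left_le power2_abs power2_eq_square)
        also have "\<dots> \<le> \<delta> / (Q + 1)" using t unfolding \<tau>_def by simp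
        finally have "t\<^sup>2 * (Q + 1) \<le> \<delta>" using Q by (simp add: pos_le_divide_eq)
        moreover have "t\<^sup>2 * Q \<le> t\<^sup>2 * (Q + 1)" by (intro mult_left_mono) auto
        ultimately show ?thesis by linarith
      qed
      have inbox: "y \<in> coord_space n \<and> sq_dist n y x \<le> \<delta>"
        if "\<And>i. i < n \<Longrightarrow> \<bar>y i - x i\<bar> \<le> \<bar>t * d i\<bar>" "y \<in> coord_space n" for y
      proof -
        have "sq_dist n y x \<le> (\<Sum>i<n. t\<^sup>2 * (d i)\<^sup>2)"
          unfolding sq_dist_def using that(1)
          by (intro sum_mono) (metis abs_le_square_iff lessThan_iff power_mult_distrib)
        also have "\<dots> = t\<^sup>2 * Q" by (simp add: Q_def sum_distrib_left)
        finally show ?thesis using tQ that by auto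
      qed
      have step: "\<bar>f (P (Suc k)) - f (P k) - t * (df k x * d k)\<bar> \<le> \<epsilon> * \<bar>t\<bar> * \<bar>d k\<bar>" if k: "k < n" for k
      proof (cases "t * d k = 0")
        case True
        then have "P (Suc k) = P k" by (auto simp: P_def fun_eq_iff less_Suc_eq)
        with True show ?thesis using \<open>\<epsilon> > 0\<close> by auto
      next
        case False
        let ?h = "\<lambda>s. f ((P k)(k := s))"
        let ?b = "x k + t * d k"
        have Pk: "P k = (P k)(k := x k)" "P (Suc k) = (P k)(k := ?b)"
          by (auto simp: P_def fun_eq_iff less_Suc_eq)
        have seg: "(P k)(k := s) \<in> coord_space n \<and> sq_dist n ((P k)(k := s)) x \<le> \<delta>"
          if "\<bar>s - x k\<bar> \<le> \<bar>t * d k\<bar>" for s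
          using that k xE d by (intro inbox) (auto simp: P_def)
        have hder: "(?h has_real_derivative df k ((P k)(k := s))) (at s)"
          if "\<bar>s - x k\<bar> \<le> \<bar>t * d k\<bar>" for s
          using der[of "(P k)(k := s)" k] nbd seg[OF that] k by auto
        have "\<exists>z. \<bar>z - x k\<bar> \<le> \<bar>t * d k\<bar> \<and> ?h ?b - ?h (x k) = t * d k * df k ((P k)(k := z))"
        proof (cases "t * d k > 0")
          case True
          then have "\<exists>z. x k < z \<and> z < ?b \<and> ?h ?b - ?h (x k) = (?b - x k) * df k ((P k)(k := z))"
            by (intro MVT2 hder) auto
          then show ?thesis by force
        next
          case False
          with \<open>t * d k \<noteq> 0\<close> have "t * d k < 0" by linarith
          then have "\<exists>z. ?b < z \<and> z < x k \<and> ?h (x k) - ?h ?b = (x k - ?b) * df k ((P k)(k := z))"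
            by (intro MVT2 hder) auto
          then obtain z where z: "?b < z" "z < x k" "?h (x k) - ?h ?b = (x k - ?b) * df k ((P k)(k := z))"
            by blast
          then show ?thesis using \<open>t * d k < 0\<close> by (intro exI[of _ z]) (auto simp: algebra_simps)
        qed
        then obtain z where z: "\<bar>z - x k\<bar> \<le> \<bar>t * d k\<bar>"
            "?h ?b - ?h (x k) = t * d k * df k ((P k)(k := z))" by blast
        have "\<bar>df k ((P k)(k := z)) - df k x\<bar> \<le> \<epsilon>"
          using nbd seg[OF z(1)] k by (meson less_imp_le)
        then have "\<bar>t * d k\<bar> * \<bar>df k ((P k)(k := z)) - df k x\<bar> \<le> \<bar>t * d k\<bar> * \<epsilon>"
          by (intro mult_left_mono) auto
        moreover have "f (P (Suc k)) - f (P k) - t * (df k x * d k)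
            = t * d k * (df k ((P k)(k := z)) - df k x)"
          using z(2) Pk by (simp add: algebra_simps)
        ultimately show ?thesis by (simp add: abs_mult mult_ac)
      qed
      have Pn: "P n = (\<lambda>i. x i + t * d i)" "P 0 = x"
        using d by (auto simp: P_def fun_eq_iff)
      have "f (\<lambda>i. x i + t * d i) - f x - t * D
          = (\<Sum>k<n. f (P (Suc k)) - f (P k) - t * (df k x * d k))"
        using sum_lessThan_telescope[of "\<lambda>k. f (P k)" n] Pn
        by (simp add: sum_subtractf D_def sum_distrib_left)
      also have "\<bar>\<dots>\<bar> \<le> (\<Sum>k<n. \<epsilon> * \<bar>t\<bar> * \<bar>d k\<bar>)"
        using step by (intro order_trans[OF sum_abs] sum_mono) auto
      also have "\<dots> = \<epsilon> * S * \<bar>t\<bar>" by (simp add: S_def sum_distrib_left mult_ac)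
      finally show ?thesis .
    qed
    with \<tau> show ?thesis by blast
  qed
  have "(\<lambda>t. (f (\<lambda>i. x i + t * d i) - f (\<lambda>i. x i + 0 * d i)) / (t - 0)) \<midarrow>0\<rightarrow> D"
  proof (rule LIM_I)
    fix e :: real assume "0 < e"
    then have "e / (2 * (S + 1)) > 0" using S by simp
    from main[OF this] obtain \<tau> where \<tau>: "\<tau> > 0"
      "\<And>t. \<bar>t\<bar> < \<tau> \<Longrightarrow> \<bar>f (\<lambda>i. x i + t * d i) - f x - t * D\<bar> \<le> e / (2 * (S + 1)) * S * \<bar>t\<bar>" by blast
    have "norm ((f (\<lambda>i. x i + t * d i) - f (\<lambda>i. x i + 0 * d i)) / (t - 0) - D) < e"
      if "t \<noteq> 0 \<and> norm (t - 0) < \<tau>" for t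
    proof -
      have t: "\<bar>t\<bar> > 0" "\<bar>t\<bar> < \<tau>" using that by auto
      have "(f (\<lambda>i. x i + t * d i) - f x) / t - D = (f (\<lambda>i. x i + t * d i) - f x - t * D) / t"
        using t by (simp add: field_simps)
      then have "\<bar>(f (\<lambda>i. x i + t * d i) - f x) / t - D\<bar> \<le> e / (2 * (S + 1)) * S"
        using \<tau>(2)[OF t(2)] t(1) by (simp add: abs_divide pos_divide_le_eq)
      also have "\<dots> < e" using S \<open>0 < e\<close> by (simp add: field_simps add_nonneg_pos)
      finally show ?thesis by (simp add: line_x)
    qed
    with \<tau>(1) show "\<exists>sa>0. \<forall>t. t \<noteq> 0 \<and> norm (t - 0) < sa \<longrightarrow>
        norm ((f (\<lambda>i. x i + t * d i) - f (\<lambda>i. x i + 0 * d i)) / (t - 0) - D) < e" by blast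
  qed
  then show ?thesis unfolding has_field_derivative_iff D_def by simp
qed

lemma smooth_on_partials:
  assumes "smooth_on n U f" "U \<subseteq> coord_space n" "set is \<subseteq> {..<n}"
  shows "continuous_on U (iter_partial is f)"
    and "\<And>i x. i < n \<Longrightarrow> x \<in> U \<Longrightarrow>
      ((\<lambda>t. iter_partial is f (x(i := t))) has_real_derivative iter_partial (i # is) f x) (at (x i))"
  using assms
  by (auto simp: smooth_on_def continuous_map_Euclidean_subspace partial_deriv_def
      DERIV_deriv_iff_field_differentiable)

lemma second_partial_nonpos_at_local_max:
  assumes W: "openin (Euclidean_space n) W" and y: "y \<in> W" and i: "i < n"
    and der: "\<And>z. z \<in> W \<Longrightarrow> ((\<lambda>t. g (z(i := t))) has_real_derivative g1 z) (at (z i))"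
    and der2: "((\<lambda>t. g1 (y(i := t))) has_real_derivative g2) (at (y i))"
    and max: "\<And>z. z \<in> W \<Longrightarrow> g z \<le> g y"
  shows "g2 \<le> 0"
proof -
  obtain T where T: "open T" "W = coord_space n \<inter> T"
    using W by (auto simp: openin_Euclidean_space_iff)
  have yE: "y \<in> coord_space n" "y \<in> T" using T y by auto
  obtain \<delta> where \<delta>: "\<delta> > 0" "\<forall>z\<in>coord_space n. sq_dist n z y \<le> \<delta> \<longrightarrow> z \<in> T"
    using open_contains_sq_ball[OF T(1) yE(2,1)] by auto
  have line: "y(i := t) \<in> W" if "\<bar>t - y i\<bar> < sqrt \<delta>" for t
  proof -
    have "sq_dist n (y(i := t)) y = (\<Sum>j<n. if j = i then (t - y i)\<^sup>2 else 0)"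
      unfolding sq_dist_def by (intro sum.cong) auto
    also have "\<dots> = (t - y i)\<^sup>2" using i by simp
    also have "\<dots> \<le> \<delta>"
      using that \<delta>(1) by (metis less_imp_le real_sqrt_abs real_sqrt_le_iff)
    finally show ?thesis using \<delta>(2) yE(1) i T(2) by auto
  qed
  show ?thesis
  proof (rule second_derivative_nonpos_at_local_max)
    show "sqrt \<delta> > 0" using \<delta>(1) by simp
    show "((\<lambda>t. g (y(i := t))) has_real_derivative g1 (y(i := t))) (at t)"
      if "\<bar>t - y i\<bar> < sqrt \<delta>" for t
      using der[OF line[OF that]] by simp
    show "((\<lambda>t. g1 (y(i := t))) has_real_derivative g2) (at (y i))" by (rule der2)
    show "g (y(i := t)) \<le> g (y(i := y i))" if "\<bar>t - y i\<bar> < sqrt \<delta>" for t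
      using max[OF line[OF that]] by simp
  qed
qed

lemma sq_dist_partials:
  assumes "i < n"
  shows "((\<lambda>t. sq_dist n (z(i := t)) x) has_real_derivative 2 * (z i - x i)) (at (z i))"
    and "((\<lambda>t. 2 * ((z(i := t)) i - x i)) has_real_derivative 2) (at (z i))"
proof -
  have "(\<Sum>j\<in>{..<n} - {i}. ((z(i := t)) j - x j)\<^sup>2) = (\<Sum>j\<in>{..<n} - {i}. (z j - x j)\<^sup>2)" for t
    by (intro sum.cong) auto
  then have "sq_dist n (z(i := t)) x = (t - x i)\<^sup>2 + (\<Sum>j\<in>{..<n} - {i}. (z j - x j)\<^sup>2)" for t
    using assms by (simp add: sq_dist_def sum.remove[of "{..<n}" i])
  then show "((\<lambda>t. sq_dist n (z(i := t)) x) has_real_derivative 2 * (z i - x i)) (at (z i))"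
    by (auto intro!: derivative_eq_intros)
  show "((\<lambda>t. 2 * ((z(i := t)) i - x i)) has_real_derivative 2) (at (z i))"
    by (auto intro!: derivative_eq_intros)
qed

section \<open>A maximum principle with Neumann boundary condition\<close>

text \<open>
  At an interior maximum all second partial derivatives are nonpositive. At a boundary maximum the
  argument is that of Hopf's lemma, with a local defining function \<open>\<rho>\<close> in place of an interior ball.
  Suppose \<open>F x0 > 0\<close>. Then the Laplacian of \<open>f\<close> is at least some \<open>c > 0\<close> near \<open>x0\<close>, and for small
  \<open>\<epsilon>\<close> and \<open>\<kappa>\<close> the function \<open>\<zeta> = f - f x0 - \<epsilon> \<rho> - \<kappa> |y - x0|\<^sup>2\<close> still has a positive Laplacian there. So \<open>\<zeta>\<close>
  has no interior maximum, while it is nonpositive on the boundary part \<open>\<rho> = 0\<close> and, when \<open>\<epsilon>\<close> is small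
  against \<open>\<kappa>\<close>, on the spherical part. Hence \<open>f - f x0 \<le> \<epsilon> \<rho> + \<kappa> |y - x0|\<^sup>2\<close>, which forces \<open>f\<close> to
  decrease at a linear rate along the inner normal. This contradicts the vanishing of the normal
  derivative.
\<close>

lemma neumann_maximum_principle:
  fixes f F :: "(nat \<Rightarrow> real) \<Rightarrow> real" and df ddf :: "nat \<Rightarrow> (nat \<Rightarrow> real) \<Rightarrow> real"
  assumes dom: "bounded_smooth_domain n \<Omega>"
    and contf: "continuous_on (closure \<Omega>) f" and contF: "continuous_on (closure \<Omega>) F"
    and der1: "\<And>y i. y \<in> \<Omega> \<Longrightarrow> i < n \<Longrightarrow>
      ((\<lambda>t. f (y(i := t))) has_real_derivative df i y) (at (y i))"
    and cont1: "\<And>i. i < n \<Longrightarrow> continuous_on \<Omega> (df i)"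
    and der2: "\<And>y i. y \<in> \<Omega> \<Longrightarrow> i < n \<Longrightarrow>
      ((\<lambda>t. df i (y(i := t))) has_real_derivative ddf i y) (at (y i))"
    and neumann: "\<And>x \<nu>. x \<in> closure \<Omega> - \<Omega> \<Longrightarrow> outer_unit_normal n \<Omega> x \<nu> \<Longrightarrow>
      ((\<lambda>y. \<Sum>i<n. df i y * \<nu> i) \<longlongrightarrow> 0) (at x within \<Omega>)"
    and lap: "\<And>y. y \<in> \<Omega> \<Longrightarrow> F y \<le> (\<Sum>i<n. ddf i y)"
    and x0: "x0 \<in> closure \<Omega>" and max: "\<And>y. y \<in> closure \<Omega> \<Longrightarrow> f y \<le> f x0"
  shows "F x0 \<le> 0"
proof (cases "x0 \<in> \<Omega>")
  case True
  have op: "openin (Euclidean_space n) \<Omega>" using dom by (simp add: bounded_smooth_domain_def)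
  have "ddf i x0 \<le> 0" if "i < n" for i
    using second_partial_nonpos_at_local_max[OF op True that, of f "df i" "ddf i x0"]
      der1 der2 True that max closure_subset[of \<Omega>] by blast
  then have "(\<Sum>i<n. ddf i x0) \<le> 0" by (intro sum_nonpos) auto
  with lap[OF True] show ?thesis by linarith
next
  case False
  have op: "openin (Euclidean_space n) \<Omega>" using dom by (simp add: bounded_smooth_domain_def)
  have E: "\<Omega> \<subseteq> coord_space n" using op by (auto simp: openin_Euclidean_space_iff)
  have cE: "closure \<Omega> \<subseteq> coord_space n" using E closed_coord_space closure_minimal by blast
  have x0E: "x0 \<in> coord_space n" using x0 cE by blast
  have fr: "Euclidean_space n frontier_of \<Omega> = closure \<Omega> - \<Omega>"
    by (simp add: frontier_of_def closure_of_Euclidean_space[OF E] interior_of_openin[OF op])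
  show ?thesis
  proof (rule ccontr)
    assume "\<not> F x0 \<le> 0"
    define c where "c = F x0 / 2"
    have c: "c > 0" using \<open>\<not> F x0 \<le> 0\<close> by (simp add: c_def)
    obtain U \<rho> where U\<rho>: "local_defining_function n \<Omega> x0 U \<rho>"
      using dom x0 False fr unfolding bounded_smooth_domain_def by blast
    have U: "openin (Euclidean_space n) U" "x0 \<in> U" and smooth: "smooth_on n U \<rho>"
      and grad: "\<exists>i<n. partial_deriv i \<rho> x0 \<noteq> 0" and \<Omega>U: "\<And>y. y \<in> U \<Longrightarrow> y \<in> \<Omega> \<longleftrightarrow> \<rho> y < 0"
      using U\<rho> unfolding local_defining_function_def by auto
    have UE: "U \<subseteq> coord_space n" using U(1) by (auto simp: openin_Euclidean_space_iff)
    define \<rho>1 where "\<rho>1 = (\<lambda>i. iter_partial [i] \<rho>)"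
    define \<rho>2 where "\<rho>2 = (\<lambda>i. iter_partial [i, i] \<rho>)"
    have cont\<rho>: "continuous_on U \<rho>" using smooth_on_partials(1)[OF smooth UE, of "[]"] by simp
    have cont\<rho>1: "continuous_on U (\<rho>1 i)" if "i < n" for i
      using smooth_on_partials(1)[OF smooth UE, of "[i]"] that by (simp add: \<rho>1_def)
    have cont\<rho>2: "continuous_on U (\<rho>2 i)" if "i < n" for i
      using smooth_on_partials(1)[OF smooth UE, of "[i,i]"] that by (simp add: \<rho>2_def)
    have der\<rho>1: "((\<lambda>t. \<rho> (y(i := t))) has_real_derivative \<rho>1 i y) (at (y i))"
      if "y \<in> U" "i < n" for y i
      using smooth_on_partials(2)[OF smooth UE, of "[]" i y] that by (simp add: \<rho>1_def)
    have der\<rho>2: "((\<lambda>t. \<rho>1 i (y(i := t))) has_real_derivative \<rho>2 i y) (at (y i))"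
      if "y \<in> U" "i < n" for y i
      using smooth_on_partials(2)[OF smooth UE, of "[i]" i y] that by (simp add: \<rho>1_def \<rho>2_def)
    define L where "L = (\<lambda>y. \<Sum>i<n. \<rho>2 i y)"
    have contL: "continuous_on U L" unfolding L_def by (intro continuous_on_sum cont\<rho>2) auto
    \<comment> \<open>A boundary point with \<open>\<rho> y > 0\<close> would have a neighbourhood disjoint from \<open>\<Omega>\<close>.\<close>
    have \<rho>0: "\<rho> y = 0" if y: "y \<in> closure \<Omega>" "y \<in> U" "y \<notin> \<Omega>" for y
    proof (rule ccontr)
      assume "\<rho> y \<noteq> 0"
      with \<Omega>U y have pos: "\<rho> y > 0" by fastforce
      obtain \<delta> where \<delta>: "\<delta> > 0" "\<forall>z\<in>U. sq_dist n z y \<le> \<delta> \<longrightarrow> \<bar>\<rho> z - \<rho> y\<bar> < \<rho> y"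
        using continuous_on_sq_ball[OF cont\<rho> y(2) UE pos] by blast
      obtain T where T: "open T" "U = coord_space n \<inter> T"
        using U(1) by (auto simp: openin_Euclidean_space_iff)
      have "open (T \<inter> {z. sq_dist n z y < \<delta>})"
        by (intro open_Int T open_Collect_less continuous_on_sq_dist continuous_intros)
      moreover have "y \<in> T \<inter> {z. sq_dist n z y < \<delta>}" using y T \<delta> by auto
      ultimately have "T \<inter> {z. sq_dist n z y < \<delta>} \<inter> \<Omega> \<noteq> {}"
        using y(1) open_Int_closure_eq_empty[of "T \<inter> {z. sq_dist n z y < \<delta>}" \<Omega>] by blast
      then obtain z where z: "z \<in> \<Omega>" "z \<in> T" "sq_dist n z y < \<delta>" by blast
      have "z \<in> U" using z T E by auto
      with \<delta>(2) z have "\<rho> z > 0" by fastforce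
      with \<Omega>U[OF \<open>z \<in> U\<close>] z(1) show False by simp
    qed
    have \<rho>x0: "\<rho> x0 = 0" using \<rho>0 x0 U(2) False by blast
    obtain \<delta>1 where \<delta>1: "\<delta>1 > 0" "\<forall>y\<in>U. sq_dist n y x0 \<le> \<delta>1 \<longrightarrow> \<bar>\<rho> y - \<rho> x0\<bar> < 1"
      using continuous_on_sq_ball[OF cont\<rho> U(2) UE zero_less_one] by blast
    obtain \<delta>2 where \<delta>2: "\<delta>2 > 0" "\<forall>y\<in>U. sq_dist n y x0 \<le> \<delta>2 \<longrightarrow> \<bar>L y - L x0\<bar> < 1"
      using continuous_on_sq_ball[OF contL U(2) UE zero_less_one] by blast
    obtain \<delta>3 where \<delta>3: "\<delta>3 > 0" "\<forall>y\<in>closure \<Omega>. sq_dist n y x0 \<le> \<delta>3 \<longrightarrow> \<bar>F y - F x0\<bar> < c"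
      using continuous_on_sq_ball[OF contF x0 cE c] by blast
    obtain \<delta>4 where \<delta>4: "\<delta>4 > 0" "\<forall>y\<in>coord_space n. sq_dist n y x0 \<le> \<delta>4 \<longrightarrow> y \<in> U"
    proof -
      obtain T where T: "open T" "U = coord_space n \<inter> T"
        using U(1) by (auto simp: openin_Euclidean_space_iff)
      have "x0 \<in> T" using T U(2) by simp
      from open_contains_sq_ball[OF T(1) this x0E] show ?thesis using T(2) that by blast
    qed
    define \<delta> where "\<delta> = min (min \<delta>1 \<delta>2) (min \<delta>3 \<delta>4)"
    have \<delta>: "\<delta> > 0" using \<delta>1 \<delta>2 \<delta>3 \<delta>4 by (simp add: \<delta>_def)
    define C where "C = \<bar>L x0\<bar> + 1"
    have C: "C > 0" by (simp add: C_def)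
    have near: "y \<in> U" "\<bar>\<rho> y\<bar> \<le> 1" "\<bar>L y\<bar> \<le> C" "F y \<ge> c"
      if y: "y \<in> closure \<Omega>" "sq_dist n y x0 \<le> \<delta>" for y
    proof -
      have *: "sq_dist n y x0 \<le> \<delta>1" "sq_dist n y x0 \<le> \<delta>2" "sq_dist n y x0 \<le> \<delta>3" "sq_dist n y x0 \<le> \<delta>4"
        using y(2) by (auto simp: \<delta>_def)
      show "y \<in> U" using \<delta>4(2) cE y(1) *(4) by blast
      show "\<bar>\<rho> y\<bar> \<le> 1" using \<delta>1(2) \<open>y \<in> U\<close> *(1) \<rho>x0 by force
      show "\<bar>L y\<bar> \<le> C" using \<delta>2(2)[rule_format, OF \<open>y \<in> U\<close> *(2)] by (simp add: C_def)
      show "F y \<ge> c" using \<delta>3(2)[rule_format, OF y(1) *(3)] unfolding c_def by linarith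
    qed
    \<comment> \<open>\<open>\<kappa>\<close> costs at most \<open>c / 2\<close> of the Laplacian and \<open>\<epsilon>\<close> at most \<open>c / 4\<close>; \<open>\<epsilon> \<le> \<kappa> \<delta>\<close> makes \<open>\<zeta>\<close>
      nonpositive where \<open>sq_dist n y x0 = \<delta>\<close>, since \<open>\<bar>\<rho>\<bar> \<le> 1\<close> there.\<close>
    define \<kappa> where "\<kappa> = c / (4 * (real n + 1))"
    have \<kappa>: "\<kappa> > 0" "2 * real n * \<kappa> \<le> c / 2" using c by (auto simp: \<kappa>_def field_simps)
    define \<epsilon> where "\<epsilon> = min (\<kappa> * \<delta>) (c / (4 * C))"
    have \<epsilon>: "\<epsilon> > 0" "\<epsilon> \<le> \<kappa> * \<delta>" using \<kappa> \<delta> c C by (auto simp: \<epsilon>_def)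
    have \<epsilon>C: "\<epsilon> * C \<le> c / 4"
    proof -
      have "\<epsilon> \<le> c / (4 * C)" by (simp add: \<epsilon>_def)
      then have "\<epsilon> * C \<le> c / (4 * C) * C" using C by (intro mult_right_mono) auto
      then show ?thesis using C by simp
    qed
    define \<zeta> where "\<zeta> = (\<lambda>y. f y - f x0 - \<epsilon> * \<rho> y - \<kappa> * sq_dist n y x0)"
    have barrier: "\<zeta> y \<le> 0" if y: "y \<in> closure \<Omega>" "sq_dist n y x0 \<le> \<delta>" for y
    proof (rule ccontr)
      assume pos: "\<not> \<zeta> y \<le> 0"
      define K where "K = closure \<Omega> \<inter> {z. sq_dist n z x0 \<le> \<delta>}"
      have "compact (closure \<Omega>)"
        using dom compact_closure_of_coord_bounded[OF E] unfolding bounded_smooth_domain_def by blast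
      moreover have "closed {z. sq_dist n z x0 \<le> \<delta>}"
        by (intro closed_Collect_le continuous_on_sq_dist continuous_intros)
      ultimately have "compact K" unfolding K_def by (rule compact_Int_closed)
      have KU: "K \<subseteq> U" using near(1) by (auto simp: K_def)
      have "continuous_on K \<zeta>"
        unfolding \<zeta>_def
        by (intro continuous_intros continuous_on_sq_dist continuous_on_subset[OF contf]
            continuous_on_subset[OF cont\<rho> KU]) (auto simp: K_def)
      moreover have "K \<noteq> {}" using y by (auto simp: K_def)
      ultimately have "\<exists>y1\<in>K. \<forall>z\<in>K. \<zeta> z \<le> \<zeta> y1"
        using continuous_attains_sup[OF \<open>compact K\<close>] by blast
      then obtain y1 where y1: "y1 \<in> K" "\<And>z. z \<in> K \<Longrightarrow> \<zeta> z \<le> \<zeta> y1" by blast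
      have y1pos: "\<zeta> y1 > 0" using y1(2)[of y] y pos by (auto simp: K_def)
      have y1c: "y1 \<in> closure \<Omega>" "sq_dist n y1 x0 \<le> \<delta>" using y1(1) by (auto simp: K_def)
      note n1 = near[OF y1c]
      have "\<kappa> * sq_dist n y1 x0 \<ge> 0" using \<kappa> by simp
      have y1\<Omega>: "y1 \<in> \<Omega>"
      proof (rule ccontr)
        assume "y1 \<notin> \<Omega>"
        then have "\<rho> y1 = 0" using \<rho>0 y1c n1 by blast
        with y1pos max[OF y1c(1)] \<open>\<kappa> * sq_dist n y1 x0 \<ge> 0\<close> show False by (simp add: \<zeta>_def)
      qed
      have y1\<delta>: "sq_dist n y1 x0 < \<delta>"
      proof (rule ccontr)
        assume "\<not> sq_dist n y1 x0 < \<delta>"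
        then have "sq_dist n y1 x0 = \<delta>" using y1c by simp
        moreover have "\<epsilon> * (- \<rho> y1) \<le> \<epsilon> * 1" using n1(2) \<epsilon> by (intro mult_left_mono) auto
        ultimately show False
          using y1pos max[OF y1c(1)] \<epsilon>(2) by (simp add: \<zeta>_def)
      qed
      define W where "W = \<Omega> \<inter> {z. sq_dist n z x0 < \<delta>}"
      have "open {z. sq_dist n z x0 < \<delta>}"
        by (intro open_Collect_less continuous_on_sq_dist continuous_intros)
      moreover obtain T where "open T" "\<Omega> = coord_space n \<inter> T"
        using op unfolding openin_Euclidean_space_iff by blast
      ultimately have "open (T \<inter> {z. sq_dist n z x0 < \<delta>})"
          "W = coord_space n \<inter> (T \<inter> {z. sq_dist n z x0 < \<delta>})"
        by (auto simp: W_def)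
      then have opW: "openin (Euclidean_space n) W"
        unfolding openin_Euclidean_space_iff by blast
      have WK: "W \<subseteq> K" using closure_subset[of \<Omega>] by (auto simp: W_def K_def)
      have y1W: "y1 \<in> W" using y1\<Omega> y1\<delta> by (simp add: W_def)
      have "ddf i y1 - \<epsilon> * \<rho>2 i y1 - \<kappa> * 2 \<le> 0" if i: "i < n" for i
      proof (rule second_partial_nonpos_at_local_max[OF opW y1W i])
        show "((\<lambda>t. \<zeta> (z(i := t))) has_real_derivative
            df i z - \<epsilon> * \<rho>1 i z - \<kappa> * (2 * (z i - x0 i))) (at (z i))" if "z \<in> W" for z
        proof -
          have "z \<in> \<Omega>" "z \<in> U" using that WK KU by (auto simp: W_def)
          then show ?thesis
            unfolding \<zeta>_def using i
            by (auto intro!: derivative_eq_intros der1 der\<rho>1 sq_dist_partials)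
        qed
        have "y1 \<in> U" using y1W WK KU by auto
        then show "((\<lambda>t. df i (y1(i := t)) - \<epsilon> * \<rho>1 i (y1(i := t)) - \<kappa> * (2 * ((y1(i := t)) i - x0 i)))
            has_real_derivative ddf i y1 - \<epsilon> * \<rho>2 i y1 - \<kappa> * 2) (at (y1 i))"
          using i y1\<Omega>
          by (intro DERIV_diff DERIV_cmult der2 der\<rho>2 sq_dist_partials) auto
        show "\<zeta> z \<le> \<zeta> y1" if "z \<in> W" for z using y1(2) WK that by blast
      qed
      then have "(\<Sum>i<n. ddf i y1) \<le> (\<Sum>i<n. \<epsilon> * \<rho>2 i y1 + \<kappa> * 2)"
        by (intro sum_mono) (fastforce simp: algebra_simps)
      also have "\<dots> = \<epsilon> * L y1 + 2 * real n * \<kappa>"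
        by (simp add: sum.distrib L_def sum_distrib_left)
      also have "\<epsilon> * L y1 \<le> \<epsilon> * C" using n1(3) \<epsilon> by (intro mult_left_mono) auto
      finally have "c \<le> c / 4 + c / 2" using lap[OF y1\<Omega>] n1(4) \<epsilon>C \<kappa>(2) by linarith
      with c show False by simp
    qed
    \<comment> \<open>The direction of the inner normal. Along it \<open>\<rho>\<close> decreases at rate \<open>S\<close>, so the barrier makes \<open>f\<close>
      drop by about \<open>\<epsilon> S h\<close>, but the derivative of \<open>f\<close> tends to \<open>0\<close>.\<close>
    define d where "d = (\<lambda>i. if i < n then - \<rho>1 i x0 else 0)"
    have dE: "d \<in> coord_space n" by (simp add: d_def)
    define \<gamma> where "\<gamma> = (\<lambda>t i. x0 i + t * d i)"
    have \<gamma>E: "\<gamma> t \<in> coord_space n" for t using x0E dE by (simp add: \<gamma>_def)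
    have \<gamma>0: "\<gamma> 0 = x0" by (simp add: \<gamma>_def)
    define S where "S = (\<Sum>i<n. (d i)\<^sup>2)"
    have S: "S > 0"
    proof -
      obtain i where i: "i < n" "partial_deriv i \<rho> x0 \<noteq> 0" using grad by blast
      then have "(d i)\<^sup>2 > 0" by (simp add: d_def \<rho>1_def)
      also have "(d i)\<^sup>2 \<le> S" unfolding S_def using i by (intro member_le_sum) auto
      finally show ?thesis .
    qed
    have sqd\<gamma>: "sq_dist n (\<gamma> t) x0 = t\<^sup>2 * S" for t
      by (simp add: sq_dist_def \<gamma>_def S_def sum_distrib_left power_mult_distrib)
    define \<nu> where "\<nu> = (\<lambda>i. if i < n then partial_deriv i \<rho> x0 / sqrt (\<Sum>j<n. (partial_deriv j \<rho> x0)\<^sup>2) else 0)"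
    have "outer_unit_normal n \<Omega> x0 \<nu>"
      unfolding outer_unit_normal_def \<nu>_def using U\<rho> by blast
    then have "((\<lambda>y. \<Sum>i<n. df i y * \<nu> i) \<longlongrightarrow> 0) (at x0 within \<Omega>)"
      using neumann x0 False by blast
    then have "((\<lambda>y. (- sqrt S) * (\<Sum>i<n. df i y * \<nu> i)) \<longlongrightarrow> (- sqrt S) * 0) (at x0 within \<Omega>)"
      by (intro tendsto_mult tendsto_const)
    moreover have "(- sqrt S) * (\<Sum>i<n. df i y * \<nu> i) = (\<Sum>i<n. df i y * d i)" for y
    proof -
      have S': "S = (\<Sum>j<n. (partial_deriv j \<rho> x0)\<^sup>2)" by (simp add: S_def d_def \<rho>1_def)
      have "(- sqrt S) * \<nu> i = d i" if "i < n" for i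
        using that S by (simp add: \<nu>_def d_def \<rho>1_def S'[symmetric])
      then show ?thesis by (auto simp: sum_distrib_left intro!: sum.cong) (metis mult.left_commute mult_minus_left)
    qed
    ultimately have "((\<lambda>y. \<Sum>i<n. df i y * d i) \<longlongrightarrow> 0) (at x0 within \<Omega>)" by simp
    from tendstoD[OF this, of "\<epsilon> * S / 4"]
    have "eventually (\<lambda>y. \<bar>\<Sum>i<n. df i y * d i\<bar> < \<epsilon> * S / 4) (at x0 within \<Omega>)"
      using \<epsilon> S by (simp add: dist_real_def)
    from eventually_at_within_sq_ball[OF this E x0E] obtain \<delta>' where \<delta>': "\<delta>' > 0"
      "\<forall>y\<in>\<Omega>. sq_dist n y x0 \<le> \<delta>' \<and> y \<noteq> x0 \<longrightarrow> \<bar>\<Sum>i<n. df i y * d i\<bar> < \<epsilon> * S / 4" by blast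
    have "((\<lambda>t. \<rho> (\<gamma> t)) has_real_derivative (\<Sum>i<n. \<rho>1 i x0 * d i)) (at 0)"
      unfolding \<gamma>_def
      by (rule directional_derivative_of_continuous_partials[OF U der\<rho>1 cont\<rho>1 dE])
    moreover have "(\<Sum>i<n. \<rho>1 i x0 * d i) = - S"
      by (simp add: S_def d_def power2_eq_square sum_negf)
    ultimately have "((\<lambda>t. \<rho> (\<gamma> t) + t * (S / 2)) has_real_derivative (- S + S / 2)) (at 0)"
      by (auto intro!: derivative_eq_intros)
    then have "\<exists>\<tau>>0. \<forall>h>0. h < \<tau> \<longrightarrow> \<rho> (\<gamma> 0) + 0 * (S / 2) > \<rho> (\<gamma> (0 + h)) + (0 + h) * (S / 2)"
      by (rule DERIV_neg_dec_right) (use S in simp)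
    then obtain \<tau> where "\<tau> > 0" and \<tau>': "\<forall>h>0. h < \<tau> \<longrightarrow> \<rho> (\<gamma> h) + h * S / 2 < 0"
      by (auto simp: \<gamma>0 \<rho>x0)
    have \<tau>: "\<tau> > 0" "\<And>h. 0 < h \<Longrightarrow> h < \<tau> \<Longrightarrow> \<rho> (\<gamma> h) < - h * S / 2"
      using \<open>\<tau> > 0\<close> \<tau>' by force+
    define \<mu> where "\<mu> = min \<delta> \<delta>'"
    \<comment> \<open>\<open>h \<le> \<epsilon> / (8 \<kappa>)\<close> bounds the quadratic term \<open>\<kappa> S h\<^sup>2\<close> by an eighth of \<open>\<epsilon> S h\<close>.\<close>
    define h where "h = min (\<tau> / 2) (min (sqrt (\<mu> / S)) (\<epsilon> / (8 * \<kappa>)))"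
    have \<mu>: "\<mu> > 0" using \<delta> \<delta>' by (simp add: \<mu>_def)
    have h: "h > 0" "h < \<tau>" "h \<le> sqrt (\<mu> / S)" "h \<le> \<epsilon> / (8 * \<kappa>)"
      using \<tau> \<mu> S \<epsilon> \<kappa> by (auto simp: h_def)
    have close: "sq_dist n (\<gamma> t) x0 \<le> \<mu>" if "0 \<le> t" "t \<le> h" for t
    proof -
      have "t \<le> sqrt (\<mu> / S)" using that h(3) by linarith
      then have "t\<^sup>2 \<le> \<mu> / S" using that \<mu> S using power_mono[OF \<open>t \<le> sqrt (\<mu> / S)\<close>, of 2] by simp
      then show ?thesis using S by (simp add: sqd\<gamma> pos_le_divide_eq)
    qed
    have \<gamma>\<Omega>: "\<gamma> t \<in> \<Omega>" if "0 < t" "t \<le> h" for t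
    proof -
      have "\<gamma> t \<in> U" using \<delta>4(2) \<gamma>E close[of t] that by (force simp: \<mu>_def \<delta>_def)
      moreover have "\<rho> (\<gamma> t) < 0" using \<tau>(2)[of t] that h(2) S
        by (smt (verit) mult_neg_pos divide_neg_pos)
      ultimately show ?thesis using \<Omega>U by blast
    qed
    have \<gamma>der: "((\<lambda>t. f (\<gamma> t)) has_real_derivative (\<Sum>i<n. df i (\<gamma> t) * d i)) (at t)"
      if "0 < t" "t \<le> h" for t
    proof -
      have "((\<lambda>s. f (\<lambda>i. \<gamma> t i + s * d i)) has_real_derivative (\<Sum>i<n. df i (\<gamma> t) * d i)) (at 0)"
        by (rule directional_derivative_of_continuous_partials[OF op \<gamma>\<Omega>[OF that] der1 cont1 dE])
      moreover have "(\<lambda>i. \<gamma> t i + s * d i) = \<gamma> (s + t)" for s by (simp add: \<gamma>_def algebra_simps)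
      ultimately have "((\<lambda>s. f (\<gamma> (s + t))) has_real_derivative (\<Sum>i<n. df i (\<gamma> t) * d i)) (at 0)" by simp
      then show ?thesis using DERIV_shift[of "\<lambda>t. f (\<gamma> t)" _ 0 t] by simp
    qed
    have \<gamma>cl: "\<gamma> t \<in> closure \<Omega>" if "t \<in> {0..h}" for t
      using \<gamma>\<Omega>[of t] that x0 \<gamma>0 closure_subset[of \<Omega>] by (cases "t = 0") auto
    have "continuous_on {0..h} \<gamma>"
      unfolding \<gamma>_def by (intro continuous_intros)
    then have "continuous_on {0..h} (\<lambda>t. f (\<gamma> t))"
      using \<gamma>cl by (intro continuous_on_compose2[OF contf]) auto
    moreover have "(\<lambda>t. f (\<gamma> t)) differentiable (at t)" if "0 < t" "t < h" for t
      using \<gamma>der[of t] that by (auto simp: real_differentiable_def)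
    ultimately obtain l z where z: "0 < z" "z < h" "DERIV (\<lambda>t. f (\<gamma> t)) z :> l"
        "f (\<gamma> h) - f (\<gamma> 0) = (h - 0) * l"
      using MVT[of 0 h "\<lambda>t. f (\<gamma> t)"] h(1) by auto
    have "l = (\<Sum>i<n. df i (\<gamma> z) * d i)" using z \<gamma>der by (intro DERIV_unique[OF z(3)]) auto
    moreover have "\<gamma> z \<in> \<Omega>" "\<gamma> z \<noteq> x0" using \<gamma>\<Omega>[of z] z False by auto
    moreover have "sq_dist n (\<gamma> z) x0 \<le> \<delta>'" using close[of z] z by (simp add: \<mu>_def)
    ultimately have "\<bar>l\<bar> < \<epsilon> * S / 4" using \<delta>'(2) by blast
    then have "h * (- (\<epsilon> * S / 4)) < h * l" using h(1) by (intro mult_strict_left_mono) auto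
    then have lower: "f (\<gamma> h) - f x0 > - (h * \<epsilon> * S / 4)" using z(4) \<gamma>0 by simp
    have "\<zeta> (\<gamma> h) \<le> 0"
      using h(1) close[of h] by (intro barrier \<gamma>cl) (auto simp: \<mu>_def)
    then have "f (\<gamma> h) - f x0 \<le> \<epsilon> * \<rho> (\<gamma> h) + \<kappa> * (h\<^sup>2 * S)"
      by (simp add: \<zeta>_def sqd\<gamma>)
    also have "\<epsilon> * \<rho> (\<gamma> h) \<le> \<epsilon> * (- h * S / 2)"
      using \<tau>(2)[OF h(1,2)] \<epsilon> by (intro mult_left_mono) auto
    also have "\<kappa> * (h\<^sup>2 * S) \<le> h * \<epsilon> * S / 8"
    proof -
      have "\<kappa> * h \<le> \<epsilon> / 8" using h(4) \<kappa> by (simp add: field_simps)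
      then have "\<kappa> * h * (h * S) \<le> \<epsilon> / 8 * (h * S)" using h S by (intro mult_right_mono) auto
      then show ?thesis by (simp add: power2_eq_square algebra_simps)
    qed
    finally have "- (h * \<epsilon> * S / 4) < \<epsilon> * (- h * S / 2) + h * \<epsilon> * S / 8" using lower by linarith
    moreover have "h * \<epsilon> * S > 0" using h \<epsilon> S by simp
    ultimately show False by (simp add: algebra_simps)
  qed
qed

section \<open>Extrema of power combinations of a solution\<close>

text \<open>
  What the comparison arguments need of a solution beyond the equations: extrema over the compact
  closure exist, and negative powers of the two components are continuous there.
\<close>

lemma positive_solution_on_closure:
  assumes dom: "bounded_smooth_domain n \<Omega>"
    and sol: "positive_smooth_solution n \<Omega> d1 d2 p q r s \<sigma> u v"
  shows "Euclidean_space n closure_of \<Omega> = closure \<Omega>" "compact (closure \<Omega>)" "closure \<Omega> \<noteq> {}"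
    "continuous_on (closure \<Omega>) u" "continuous_on (closure \<Omega>) v"
    "\<And>y. y \<in> closure \<Omega> \<Longrightarrow> u y > 0 \<and> v y > 0"
proof -
  have op: "openin (Euclidean_space n) \<Omega>" using dom by (simp add: bounded_smooth_domain_def)
  have E: "\<Omega> \<subseteq> coord_space n" using op by (auto simp: openin_Euclidean_space_iff)
  have cE: "closure \<Omega> \<subseteq> coord_space n" using E closed_coord_space closure_minimal by blast
  show cl: "Euclidean_space n closure_of \<Omega> = closure \<Omega>" by (rule closure_of_Euclidean_space[OF E])
  show "compact (closure \<Omega>)"
    using dom compact_closure_of_coord_bounded[OF E] unfolding bounded_smooth_domain_def by blast
  show "closure \<Omega> \<noteq> {}" using dom by (simp add: bounded_smooth_domain_def)
  show "continuous_on (closure \<Omega>) u" "continuous_on (closure \<Omega>) v"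
    using sol unfolding positive_smooth_solution_def smooth_on_closure_def cl
      continuous_map_Euclidean_subspace[OF cE] by auto
  show "u y > 0 \<and> v y > 0" if "y \<in> closure \<Omega>" for y
    using sol that unfolding positive_smooth_solution_def cl by auto
qed

text \<open>
  The comparison argument uses the differential equations only here. The Laplacian of \<open>\<alpha> u\<^sup>B + \<beta> v\<close> is
  \<open>\<alpha> B u\<^bsup>B-1\<^esup> \<Delta>u + \<beta> \<Delta>v\<close> plus the gradient term \<open>\<alpha> B (B - 1) u\<^bsup>B-2\<^esup> |\<nabla>u|\<^sup>2\<close>, whose sign the assumption on
  \<open>\<alpha> B (B - 1)\<close> makes favourable. The equations express \<open>\<Delta>u\<close> and \<open>\<Delta>v\<close> through \<open>u\<close> and \<open>v\<close>, so the
  lower bound extends continuously to the closure and the maximum principle applies.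
\<close>

lemma extremum_of_power_combination:
  assumes dom: "bounded_smooth_domain n \<Omega>" and d: "d1 > 0" "d2 > 0"
    and sol: "positive_smooth_solution n \<Omega> d1 d2 p q r s \<sigma> u v"
    and conv: "0 \<le> \<alpha> * B * (B - 1)"
    and x0: "x0 \<in> closure \<Omega>"
    and max: "\<And>y. y \<in> closure \<Omega> \<Longrightarrow> \<alpha> * u y powr B + \<beta> * v y \<le> \<alpha> * u x0 powr B + \<beta> * v x0"
  shows "\<alpha> * B * u x0 powr (B - 1) * ((u x0 - u x0 powr p / v x0 powr q - \<sigma>) / d1)
    + \<beta> * ((v x0 - u x0 powr r / v x0 powr s) / d2) \<le> 0"
proof -
  have op: "openin (Euclidean_space n) \<Omega>" using dom by (simp add: bounded_smooth_domain_def)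
  have E: "\<Omega> \<subseteq> coord_space n" using op by (auto simp: openin_Euclidean_space_iff)
  have cE: "closure \<Omega> \<subseteq> coord_space n" using E closed_coord_space closure_minimal by blast
  note cl = positive_solution_on_closure[OF dom sol]
  have fr: "Euclidean_space n frontier_of \<Omega> = closure \<Omega> - \<Omega>"
    by (simp add: frontier_of_def cl(1) interior_of_openin[OF op])
  have sm: "smooth_on n \<Omega> u" "smooth_on n \<Omega> v"
    using sol by (auto simp: positive_smooth_solution_def smooth_on_closure_def)
  note cont = cl(4,5)
  have pos: "u x > 0" "v x > 0" if "x \<in> closure \<Omega>" for x
    using cl(6)[OF that] by auto
  have pos': "u x > 0" "v x > 0" if "x \<in> \<Omega>" for x
    using pos[of x] that closure_subset[of \<Omega>] by auto
  define Lu where "Lu = (\<lambda>x. (u x - u x powr p / v x powr q - \<sigma>) / d1)"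
  define Lv where "Lv = (\<lambda>x. (v x - u x powr r / v x powr s) / d2)"
  have lapu: "laplacian n u x = Lu x" and lapv: "laplacian n v x = Lv x" if "x \<in> \<Omega>" for x
    using sol that d unfolding positive_smooth_solution_def Lu_def Lv_def
    by (auto simp: field_simps)
  define ui where "ui = (\<lambda>i. iter_partial [i] u)"
  define vi where "vi = (\<lambda>i. iter_partial [i] v)"
  define uii where "uii = (\<lambda>i. iter_partial [i, i] u)"
  define vii where "vii = (\<lambda>i. iter_partial [i, i] v)"
  have du: "((\<lambda>t. u (y(i := t))) has_real_derivative ui i y) (at (y i))"
    and dv: "((\<lambda>t. v (y(i := t))) has_real_derivative vi i y) (at (y i))"
    and dui: "((\<lambda>t. ui i (y(i := t))) has_real_derivative uii i y) (at (y i))"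
    and dvi: "((\<lambda>t. vi i (y(i := t))) has_real_derivative vii i y) (at (y i))"
    if "y \<in> \<Omega>" "i < n" for y i
    using smooth_on_partials(2)[OF sm(1) E, of "[]" i y] smooth_on_partials(2)[OF sm(2) E, of "[]" i y]
      smooth_on_partials(2)[OF sm(1) E, of "[i]" i y] smooth_on_partials(2)[OF sm(2) E, of "[i]" i y]
      that by (simp_all add: ui_def vi_def uii_def vii_def del: fun_upd_apply)
  have cui: "continuous_on \<Omega> (ui i)" and cvi: "continuous_on \<Omega> (vi i)" if "i < n" for i
    using smooth_on_partials(1)[OF sm(1) E, of "[i]"] smooth_on_partials(1)[OF sm(2) E, of "[i]"] that
    by (simp_all add: ui_def vi_def)
  define f where "f = (\<lambda>y. \<alpha> * u y powr B + \<beta> * v y)"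
  define F where "F = (\<lambda>y. \<alpha> * B * u y powr (B - 1) * Lu y + \<beta> * Lv y)"
  define df where "df = (\<lambda>i y. \<alpha> * (B * u y powr (B - 1) * ui i y) + \<beta> * vi i y)"
  define ddf where "ddf = (\<lambda>i y. \<alpha> * (B * ((B - 1) * u y powr (B - 2) * ui i y * ui i y
    + u y powr (B - 1) * uii i y)) + \<beta> * vii i y)"
  have dpow: "((\<lambda>t. u (y(i := t)) powr c) has_real_derivative c * u y powr (c - 1) * ui i y) (at (y i))"
    if "y \<in> \<Omega>" "i < n" for y i c
    using DERIV_fun_powr[OF du[OF that], of c] pos'(1)[OF that(1)] by simp
  have "F x0 \<le> 0"
  proof (rule neumann_maximum_principle[OF dom, where f = f and F = F and df = df and ddf = ddf])
    show "continuous_on (closure \<Omega>) f"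
      unfolding f_def using pos by (intro continuous_intros cont) force+
    show "continuous_on (closure \<Omega>) F"
      unfolding F_def Lu_def Lv_def using pos d by (intro continuous_intros cont) force+
    show "((\<lambda>t. f (y(i := t))) has_real_derivative df i y) (at (y i))" if "y \<in> \<Omega>" "i < n" for y i
      unfolding f_def df_def using that by (intro DERIV_add DERIV_cmult dpow dv)
    show "continuous_on \<Omega> (df i)" if "i < n" for i
      unfolding df_def using pos' that
      by (intro continuous_intros cui cvi continuous_on_subset[OF cont(1) closure_subset]) force+
    show "((\<lambda>t. df i (y(i := t))) has_real_derivative ddf i y) (at (y i))" if "y \<in> \<Omega>" "i < n" for y i
    proof -
      have "((\<lambda>t. B * u (y(i := t)) powr (B - 1) * ui i (y(i := t))) has_real_derivative
          B * ((B - 1) * u y powr (B - 2) * ui i y * ui i y + u y powr (B - 1) * uii i y)) (at (y i))"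
        using DERIV_cmult[OF DERIV_mult[OF dpow[OF that, of "B - 1"] dui[OF that]], of B]
        by (simp add: algebra_simps)
      then show ?thesis
        unfolding df_def ddf_def by (intro DERIV_add DERIV_cmult dvi that)
    qed
    show "((\<lambda>y. \<Sum>i<n. df i y * \<nu> i) \<longlongrightarrow> 0) (at x within \<Omega>)"
      if x: "x \<in> closure \<Omega> - \<Omega>" and \<nu>: "outer_unit_normal n \<Omega> x \<nu>" for x \<nu>
    proof -
      have "x \<in> coord_space n" using x cE by blast
      note at = atin_within_Euclidean_space[OF this E]
      have "has_normal_derivative n \<Omega> u x \<nu> 0" "has_normal_derivative n \<Omega> v x \<nu> 0"
        using sol x \<nu> unfolding positive_smooth_solution_def neumann_condition_def fr by auto
      then have nu: "((\<lambda>y. \<Sum>i<n. ui i y * \<nu> i) \<longlongrightarrow> 0) (at x within \<Omega>)"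
        and nv: "((\<lambda>y. \<Sum>i<n. vi i y * \<nu> i) \<longlongrightarrow> 0) (at x within \<Omega>)"
        unfolding has_normal_derivative_def at ui_def vi_def by simp_all
      have "(u \<longlongrightarrow> u x) (at x within closure \<Omega>)"
        using cont(1) x by (simp add: continuous_on)
      then have "(u \<longlongrightarrow> u x) (at x within \<Omega>)"
        by (rule tendsto_within_subset) (rule closure_subset)
      then have up: "((\<lambda>y. u y powr (B - 1)) \<longlongrightarrow> u x powr (B - 1)) (at x within \<Omega>)"
        using pos(1)[of x] x by (intro tendsto_powr tendsto_const) auto
      have "((\<lambda>y. \<alpha> * B * u y powr (B - 1) * (\<Sum>i<n. ui i y * \<nu> i) + \<beta> * (\<Sum>i<n. vi i y * \<nu> i))
          \<longlongrightarrow> \<alpha> * B * u x powr (B - 1) * 0 + \<beta> * 0) (at x within \<Omega>)"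
        by (intro tendsto_add tendsto_mult tendsto_const up nu nv)
      moreover have "\<alpha> * B * u y powr (B - 1) * (\<Sum>i<n. ui i y * \<nu> i) + \<beta> * (\<Sum>i<n. vi i y * \<nu> i)
          = (\<Sum>i<n. df i y * \<nu> i)" for y
        by (simp add: df_def sum_distrib_left sum.distrib algebra_simps)
      ultimately show ?thesis by simp
    qed
    show "F y \<le> (\<Sum>i<n. ddf i y)" if y: "y \<in> \<Omega>" for y
    proof -
      have "ddf i y = \<alpha> * B * (B - 1) * (u y powr (B - 2) * (ui i y)\<^sup>2)
          + \<alpha> * B * u y powr (B - 1) * uii i y + \<beta> * vii i y" for i
        by (simp add: ddf_def algebra_simps power2_eq_square)
      then have "(\<Sum>i<n. ddf i y) = \<alpha> * B * (B - 1) * (\<Sum>i<n. u y powr (B - 2) * (ui i y)\<^sup>2)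
          + \<alpha> * B * u y powr (B - 1) * (\<Sum>i<n. uii i y) + \<beta> * (\<Sum>i<n. vii i y)"
        by (simp only: sum_distrib_left sum.distrib)
      also have "(\<Sum>i<n. uii i y) = Lu y" using lapu[OF y] by (simp add: laplacian_def uii_def)
      also have "(\<Sum>i<n. vii i y) = Lv y" using lapv[OF y] by (simp add: laplacian_def vii_def)
      also have "\<alpha> * B * (B - 1) * (\<Sum>i<n. u y powr (B - 2) * (ui i y)\<^sup>2)
          + \<alpha> * B * u y powr (B - 1) * Lu y + \<beta> * Lv y \<ge> F y"
        using conv by (simp add: F_def sum_nonneg)
      finally show ?thesis .
    qed
    show "x0 \<in> closure \<Omega>" by (rule x0)
    show "f y \<le> f x0" if "y \<in> closure \<Omega>" for y using max[OF that] by (simp add: f_def)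
  qed
  then show ?thesis by (simp add: F_def Lu_def Lv_def)
qed

section \<open>Production away from the equilibrium\<close>

text \<open>
  With \<open>X = u\<^sup>r / v\<^bsup>s+1\<^esup>\<close> the variable \<open>v\<close> disappears from the production term of \<open>u\<close>. The remaining
  exponent of \<open>u\<close> is negative exactly when \<open>(p - 1) / r < q / (s + 1)\<close>.
\<close>

lemma production_in_terms_of_quotient:
  fixes u v p q r s :: real
  assumes "u > 0" "v > 0" "s \<ge> 0"
  shows "u powr (p - 1) / v powr q
    = (u powr r / v powr (s + 1)) powr (q / (s + 1)) * u powr - (q * r / (s + 1) - (p - 1))"
proof -
  have "(u powr r / v powr (s + 1)) powr (q / (s + 1)) = u powr (r * (q / (s + 1))) / v powr q"
    using assms by (simp add: powr_divide powr_powr)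
  moreover have "u powr (r * (q / (s + 1))) * u powr - (q * r / (s + 1) - (p - 1)) = u powr (p - 1)"
    by (simp flip: powr_add add: algebra_simps)
  ultimately show ?thesis by simp
qed

lemma powr_le_cancel2:
  fixes x y c :: real
  assumes "0 < c" "0 \<le> x" "y powr c \<le> x powr c"
  shows "y \<le> x"
  using assms powr_less_mono2[of c x y] by linarith

text \<open>
  \<open>A\<close> is the value of the quotient \<open>u\<^sup>r / v\<^bsup>s+1\<^esup>\<close> at which production and decay of the first component
  balance when this component equals \<open>U\<close>.
\<close>

lemma quotient_comparison:
  fixes a b \<sigma> U :: real
  assumes "a > 0" "U > 0" "\<sigma> < U"
  defines "A \<equiv> ((1 - \<sigma> / U) * U powr b) powr (1 / a)"
  shows "A > 0" "A powr a * U powr - b = 1 - \<sigma> / U"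
    "\<And>X. X > 0 \<Longrightarrow> A \<le> X \<longleftrightarrow> 1 - \<sigma> / U \<le> X powr a * U powr - b"
proof -
  have pos: "1 - \<sigma> / U > 0" using assms by simp
  then have "(1 - \<sigma> / U) * U powr b > 0" using assms by simp
  then have "(1 - \<sigma> / U) * U powr b \<noteq> 0" by linarith
  then show "A > 0" by (simp only: A_def powr_gt_zero not_False_eq_True)
  have Aa: "A powr a = (1 - \<sigma> / U) * U powr b"
    unfolding A_def using assms pos by (simp add: powr_powr)
  then show eq: "A powr a * U powr - b = 1 - \<sigma> / U"
    using assms by (simp add: powr_minus)
  fix X :: real assume "X > 0"
  have "A \<le> X \<longleftrightarrow> A powr a \<le> X powr a"
    using powr_mono2[of a A X] powr_le_cancel2[of a X A] \<open>X > 0\<close> \<open>A > 0\<close> \<open>a > 0\<close> by auto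
  also have "\<dots> \<longleftrightarrow> A powr a * U powr - b \<le> X powr a * U powr - b" using \<open>U > 0\<close> by simp
  finally show "A \<le> X \<longleftrightarrow> 1 - \<sigma> / U \<le> X powr a * U powr - b" using eq by simp
qed

text \<open>
  Here \<open>U\<close> is the maximum of \<open>u\<close> and \<open>t U\<close> its value at the minimum of \<open>v / u\<^sup>B\<close>, \<open>X0\<close> and \<open>X\<close> are the
  quotients \<open>u\<^sup>r / v\<^bsup>s+1\<^esup>\<close> at these points, and \<open>e = B (s + 1) - r\<close>. Let \<open>A > 1\<close> be the balancing quotient
  at \<open>U\<close> and \<open>R = X / A\<close>, so that \<open>t\<^bsup>-e\<^esup> \<le> R\<close>. Because \<open>e\<close> is large, the factors \<open>t\<^bsup>-b\<^esup>\<close> and \<open>1 / t\<close> in the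
  production of \<open>u\<close> are at most \<open>R\<^bsup>1-a\<^esup>\<close> and \<open>R\<close>, and the production is at most \<open>R\<close> times its value \<open>1\<close>
  at the pair \<open>U, A\<close>. So its excess over \<open>1\<close> is at most \<open>R - 1 < A R - 1 = X - 1\<close>. Room for a large \<open>e\<close>
  exists because \<open>a < 1\<close>.
\<close>

lemma production_gap_above_equilibrium:
  fixes a b e \<sigma> t U X X0 k :: real
  assumes "0 < a" "a < 1" "1 \<le> e" "b \<le> e * (1 - a)" "0 \<le> \<sigma>" "0 < U" "0 < t" "t \<le> 1"
    and above: "U powr - b + \<sigma> / U < 1"
    and X0: "0 < X0" "1 \<le> X0 powr a * U powr - b + \<sigma> / U"
    and X: "X0 * t powr - e \<le> X"
    and k: "0 \<le> k" "k \<le> 1"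
  shows "k * (X powr a * (t * U) powr - b + \<sigma> / (t * U) - 1) < X - 1"
proof -
  define A where "A = ((1 - \<sigma> / U) * U powr b) powr (1 / a)"
  have "U powr - b > 0" using assms by simp
  with above have "\<sigma> / U < 1" by linarith
  then have \<sigma>U: "\<sigma> < U" using assms by simp
  note A = quotient_comparison[OF \<open>0 < a\<close> \<open>0 < U\<close> \<sigma>U, where b = b, folded A_def]
  have A1: "A > 1" using A(3)[of 1] above by simp
  have AX0: "A \<le> X0" using A(3)[OF X0(1)] X0(2) by linarith
  define R where "R = X / A"
  have "A * t powr - e \<le> X0 * t powr - e" using AX0 by (intro mult_right_mono) auto
  with X have "A * t powr - e \<le> X" by linarith
  then have Rt: "t powr - e \<le> R" using A(1) by (simp add: R_def pos_le_divide_eq mult.commute)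
  have X_eq: "X = A * R" using A(1) by (simp add: R_def)
  have mono: "t powr - c \<le> t powr - c'" if "c \<le> c'" for c c'
    using that assms by (intro powr_mono') auto
  have R1: "1 \<le> R" using mono[of 0 e] Rt assms by simp
  have tb: "t powr - b \<le> R powr (1 - a)"
  proof -
    have "t powr - b \<le> t powr - (e * (1 - a))" by (rule mono) fact
    also have "\<dots> = (t powr - e) powr (1 - a)" by (simp add: powr_powr)
    also have "\<dots> \<le> R powr (1 - a)" using Rt assms by (intro powr_mono2) auto
    finally show ?thesis .
  qed
  have t1: "1 / t \<le> R"
    using mono[of 1 e] Rt powr_neg_one[OF \<open>0 < t\<close>] \<open>1 \<le> e\<close> by linarith
  have "X powr a * (t * U) powr - b = (R powr a * t powr - b) * (A powr a * U powr - b)"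
    using A(1) R1 assms by (simp add: X_eq powr_mult)
  also have "\<dots> \<le> (R powr a * R powr (1 - a)) * (1 - \<sigma> / U)"
    unfolding A(2) using tb \<sigma>U assms by (intro mult_right_mono mult_left_mono) auto
  also have "R powr a * R powr (1 - a) = R" using R1 by (simp flip: powr_add)
  finally have "X powr a * (t * U) powr - b \<le> R * (1 - \<sigma> / U)" .
  moreover have "\<sigma> / (t * U) \<le> R * (\<sigma> / U)"
    using mult_right_mono[OF t1, of "\<sigma> / U"] assms by simp
  ultimately have "X powr a * (t * U) powr - b + \<sigma> / (t * U) - 1 \<le> R - 1"
    by (simp add: algebra_simps)
  then have "k * (X powr a * (t * U) powr - b + \<sigma> / (t * U) - 1) \<le> k * (R - 1)"
    using k by (intro mult_left_mono) auto
  also have "\<dots> \<le> 1 * (R - 1)" using k R1 by (intro mult_right_mono) auto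
  also have "\<dots> < A * R - 1" using A1 R1 by simp
  finally show ?thesis by (simp add: X_eq)
qed

text \<open>
  Bernoulli's inequality with a real exponent.
\<close>

lemma one_minus_powr_le:
  fixes R m :: real
  assumes "0 < R" "1 \<le> m" "R \<le> 1"
  shows "1 - R powr m \<le> m * (1 - R)"
proof (cases "R = 1")
  case False
  with assms have "R < 1" by simp
  have "\<exists>z. R < z \<and> z < 1 \<and> 1 powr m - R powr m = (1 - R) * (m * z powr (m - 1))"
    using assms \<open>R < 1\<close> by (intro MVT2 has_real_derivative_powr) auto
  then obtain z where z: "R < z" "z < 1" "1 - R powr m = (1 - R) * (m * z powr (m - 1))" by auto
  have "z powr (m - 1) \<le> 1" using z assms by (intro powr_le1) auto
  then have "m * z powr (m - 1) \<le> m" using assms by (simp add: mult_left_le)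
  then show ?thesis using z \<open>R < 1\<close> by (simp add: mult.commute mult_left_mono)
qed simp

text \<open>
  The counterpart at the minimum \<open>U\<close> of \<open>u\<close> and the maximum of \<open>v / u\<close>, with \<open>e = s + 1 - r\<close>. Now \<open>A < 1\<close>,
  \<open>R \<le> t\<^bsup>-e\<^esup> \<le> 1\<close>, and the powers of \<open>t\<close> are bounded below by powers of \<open>R\<close>, so the production is at least
  \<open>R\<^sup>m\<close>. Bernoulli's inequality bounds its deficit \<open>1 - R\<^sup>m\<close> by \<open>m (1 - R)\<close>, and
  \<open>1 - R < 1 - A R = 1 - X\<close>.
\<close>

lemma production_gap_below_equilibrium:
  fixes a b e \<sigma> t U X X0 k m :: real
  assumes "0 < a" "0 < b" "0 < e" "0 \<le> \<sigma>" "0 < U" "1 \<le> t"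
    and m: "1 \<le> m" "a + b / e \<le> m" "1 / e \<le> m"
    and below: "1 < U powr - b + \<sigma> / U"
    and X0: "0 < X0" "X0 powr a * U powr - b + \<sigma> / U \<le> 1"
    and X: "0 < X" "X \<le> X0 * t powr - e"
    and k: "0 \<le> k" "k * m \<le> 1"
  shows "k * (1 - (X powr a * (t * U) powr - b + \<sigma> / (t * U))) < 1 - X"
proof -
  define A where "A = ((1 - \<sigma> / U) * U powr b) powr (1 / a)"
  have "X0 powr a * U powr - b > 0" using assms by simp
  with X0(2) have "\<sigma> / U < 1" by linarith
  then have \<sigma>U: "\<sigma> < U" using assms by simp
  note A = quotient_comparison[OF \<open>0 < a\<close> \<open>0 < U\<close> \<sigma>U, where b = b, folded A_def]
  have A1: "A < 1"
  proof (rule ccontr)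
    assume "\<not> A < 1"
    then have "1 powr a \<le> A powr a" using assms by (intro powr_mono2) auto
    then have "1 * U powr - b \<le> A powr a * U powr - b" by (intro mult_right_mono) auto
    with A(2) below show False by simp
  qed
  have AX0: "X0 \<le> A"
  proof (rule ccontr)
    assume "\<not> X0 \<le> A"
    then have "A powr a < X0 powr a" using A(1) assms by (intro powr_less_mono2) auto
    then have "A powr a * U powr - b < X0 powr a * U powr - b"
      using assms by (intro mult_strict_right_mono) auto
    with A(2) X0(2) show False by simp
  qed
  define R where "R = X / A"
  have X_eq: "X = A * R" using A(1) by (simp add: R_def)
  have R0: "R > 0" using A(1) X(1) by (simp add: R_def)
  have "X0 * t powr - e \<le> A * t powr - e" using AX0 by (intro mult_right_mono) auto
  with X have "X \<le> A * t powr - e" by linarith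
  then have Rt: "R \<le> t powr - e" using A(1) by (simp add: R_def pos_divide_le_eq mult.commute)
  have "t powr - e \<le> t powr 0" using assms by (intro powr_mono) auto
  then have R1: "R \<le> 1" using Rt assms by simp
  have Rc: "R powr (c / e) \<le> t powr - c" if "0 < c" for c
  proof -
    have "R powr (c / e) \<le> (t powr - e) powr (c / e)"
      using Rt R0 that assms by (intro powr_mono2) auto
    then show ?thesis using assms by (simp add: powr_powr)
  qed
  have Rm: "R powr m \<le> R powr c" if "c \<le> m" for c
    using R0 R1 that by (intro powr_mono') auto
  have "R powr m * (1 - \<sigma> / U) \<le> (R powr a * t powr - b) * (1 - \<sigma> / U)"
  proof (rule mult_right_mono)
    have "R powr m \<le> R powr a * R powr (b / e)" using Rm[OF m(2)] by (simp add: powr_add)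
    also have "\<dots> \<le> R powr a * t powr - b" using Rc[of b] assms by (intro mult_left_mono) auto
    finally show "R powr m \<le> R powr a * t powr - b" .
  qed (use \<sigma>U assms in auto)
  also have "\<dots> = X powr a * (t * U) powr - b"
    using A(1) A(2)[symmetric] R0 assms by (simp add: X_eq powr_mult)
  finally have 1: "R powr m * (1 - \<sigma> / U) \<le> X powr a * (t * U) powr - b" .
  have "R powr m * (\<sigma> / U) \<le> t powr - 1 * (\<sigma> / U)"
    using Rm[OF m(3)] Rc[of 1] assms by (intro mult_right_mono) auto
  then have 2: "R powr m * (\<sigma> / U) \<le> \<sigma> / (t * U)"
    using assms by (simp add: powr_minus divide_inverse mult_ac)
  have "1 - (X powr a * (t * U) powr - b + \<sigma> / (t * U)) \<le> 1 - R powr m"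
    using 1 2 by (simp add: algebra_simps)
  also have "\<dots> \<le> m * (1 - R)" by (rule one_minus_powr_le) fact+
  finally have "k * (1 - (X powr a * (t * U) powr - b + \<sigma> / (t * U))) \<le> k * (m * (1 - R))"
    using k by (intro mult_left_mono) auto
  also have "\<dots> = (k * m) * (1 - R)" by simp
  also have "\<dots> \<le> 1 * (1 - R)" using k R1 by (intro mult_right_mono) auto
  also have "\<dots> < 1 - A * R" using A1 R0 by simp
  finally show ?thesis by (simp add: X_eq)
qed

section \<open>The constant solution\<close>

lemma equilibrium_exists:
  fixes b \<sigma> :: real
  assumes "b > 0" "\<sigma> \<ge> 0"
  shows "\<exists>x>0. x powr - b + \<sigma> / x = 1"
proof -
  \<comment> \<open>Each of the two summands is at most \<open>1 / 2\<close> at \<open>N\<close>.\<close>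
  define N where "N = max (2 powr (1 / b)) (2 * \<sigma>)"
  have "2 powr 0 \<le> (2::real) powr (1 / b)" using assms by (intro powr_mono) auto
  then have N: "1 \<le> N" "2 powr (1 / b) \<le> N" "2 * \<sigma> \<le> N" by (auto simp: N_def)
  have "N powr - b \<le> (2 powr (1 / b)) powr - b"
    using N assms by (intro powr_mono2') auto
  then have "N powr - b \<le> 1 / 2" using assms by (simp add: powr_powr powr_minus)
  moreover have "\<sigma> / N \<le> 1 / 2" using N by (simp add: field_simps)
  ultimately have "N powr - b + \<sigma> / N \<le> 1" by linarith
  moreover have "continuous_on {1..N} (\<lambda>x. x powr - b + \<sigma> / x)"
    by (intro continuous_intros) auto
  ultimately have "\<exists>x\<ge>1. x \<le> N \<and> x powr - b + \<sigma> / x = 1"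
    using N assms by (intro IVT2') auto
  then obtain x where "1 \<le> x" "x powr - b + \<sigma> / x = 1" by blast
  then show ?thesis by (intro exI[of _ x]) simp
qed

lemma equilibrium_strict_decreasing:
  fixes b \<sigma> x y :: real
  assumes "b > 0" "\<sigma> \<ge> 0" "0 < x" "x < y"
  shows "y powr - b + \<sigma> / y < x powr - b + \<sigma> / x"
proof -
  have "y powr - b < x powr - b" using assms by (intro powr_less_mono2_neg) auto
  moreover have "\<sigma> / y \<le> \<sigma> / x" using assms by (intro divide_left_mono) auto
  ultimately show ?thesis by linarith
qed

lemma iter_partial_const: "iter_partial is (\<lambda>_. c) = (\<lambda>_. if is = [] then c else 0)"
  by (induction "is") (auto simp: partial_deriv_def fun_eq_iff)

lemma laplacian_const: "laplacian n (\<lambda>_. c) x = 0"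
  by (simp add: laplacian_def iter_partial_const del: iter_partial.simps)

lemma smooth_on_closure_const: "smooth_on_closure n \<Omega> (\<lambda>_. c)"
proof -
  have "smooth_on n \<Omega> (\<lambda>_. c)"
    by (simp add: smooth_on_def iter_partial_const)
  moreover have "\<exists>g. continuous_map (subtopology (Euclidean_space n) (Euclidean_space n closure_of \<Omega>))
      euclideanreal g \<and> (\<forall>x\<in>\<Omega>. g x = iter_partial is (\<lambda>_. c) x)" for "is"
    by (intro exI[of _ "\<lambda>_. if is = [] then c else 0"]) (simp add: iter_partial_const)
  ultimately show ?thesis by (simp add: smooth_on_closure_def)
qed

lemma neumann_condition_const: "neumann_condition n \<Omega> (\<lambda>_. c)"
  by (simp add: neumann_condition_def has_normal_derivative_def partial_deriv_def)

text \<open>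
  Both the uniqueness behind \<^const>\<open>constant_solution\<close> and the equations for its value come from this
  description, in which the second component is determined by the first.
\<close>

lemma constant_pair_is_solution_iff:
  assumes "s \<ge> 0" and ne: "\<Omega> \<noteq> {}" and E: "\<Omega> \<subseteq> topspace (Euclidean_space n)"
  shows "positive_smooth_solution n \<Omega> d1 d2 p q r s \<sigma> (\<lambda>_. x) (\<lambda>_. y) \<longleftrightarrow>
    x > 0 \<and> y > 0 \<and> y powr (s + 1) = x powr r \<and> x powr - (q * r / (s + 1) - (p - 1)) + \<sigma> / x = 1"
proof -
  have "Euclidean_space n closure_of \<Omega> \<noteq> {}"
    using ne E closure_of_subset[OF E] by blast
  then have "positive_smooth_solution n \<Omega> d1 d2 p q r s \<sigma> (\<lambda>_. x) (\<lambda>_. y) \<longleftrightarrow>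
      x > 0 \<and> y > 0 \<and> - x + x powr p / y powr q + \<sigma> = 0 \<and> - y + x powr r / y powr s = 0"
    using ne by (auto simp: positive_smooth_solution_def laplacian_const smooth_on_closure_const
        neumann_condition_const)
  also have "\<dots> \<longleftrightarrow> x > 0 \<and> y > 0 \<and> y powr (s + 1) = x powr r
      \<and> x powr - (q * r / (s + 1) - (p - 1)) + \<sigma> / x = 1"
  proof (cases "x > 0 \<and> y > 0")
    case True
    then have xy: "x > 0" "y > 0" by auto
    have v: "- y + x powr r / y powr s = 0 \<longleftrightarrow> y powr (s + 1) = x powr r"
      using xy by (auto simp: powr_add field_simps)
    have u: "- x + x powr p / y powr q + \<sigma> = 0 \<longleftrightarrow> x powr (p - 1) / y powr q + \<sigma> / x = 1"
      using xy by (auto simp: powr_diff field_simps)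
    have "x powr (p - 1) / y powr q = x powr - (q * r / (s + 1) - (p - 1))"
      if "y powr (s + 1) = x powr r"
      using production_in_terms_of_quotient[OF xy assms(1), of p q r] that xy by simp
    then show ?thesis unfolding u v using xy by auto
  qed blast
  finally show ?thesis .
qed

text \<open>
  The definite description in \<^const>\<open>constant_solution\<close> denotes because \<open>x\<^bsup>-b\<^esup> + \<sigma> / x\<close> is strictly
  decreasing and takes the value \<open>1\<close>.
\<close>

lemma constant_solution_eqns:
  assumes "s \<ge> 0" "\<sigma> \<ge> 0" and b: "q * r / (s + 1) - (p - 1) > 0"
    and dom: "bounded_smooth_domain n \<Omega>"
    and c: "(us, vs) = constant_solution n \<Omega> d1 d2 p q r s \<sigma>"
  shows "us > 0" "vs > 0" "vs powr (s + 1) = us powr r"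
    "us powr - (q * r / (s + 1) - (p - 1)) + \<sigma> / us = 1"
proof -
  let ?b = "q * r / (s + 1) - (p - 1)"
  have "\<Omega> \<noteq> {}" "\<Omega> \<subseteq> topspace (Euclidean_space n)"
    using dom openin_subset by (auto simp: bounded_smooth_domain_def)
  note iff = constant_pair_is_solution_iff[OF \<open>s \<ge> 0\<close> this, of d1 d2 p q r \<sigma>]
  let ?P = "\<lambda>c. positive_smooth_solution n \<Omega> d1 d2 p q r s \<sigma> (\<lambda>_. fst c) (\<lambda>_. snd c)"
  obtain x where x: "x > 0" "x powr - ?b + \<sigma> / x = 1"
    using equilibrium_exists[OF b \<open>\<sigma> \<ge> 0\<close>] by blast
  define y where "y = x powr (r / (s + 1))"
  have y: "y > 0" "y powr (s + 1) = x powr r"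
    using x(1) \<open>s \<ge> 0\<close> by (auto simp: y_def powr_powr)
  have "\<exists>!c. ?P c"
  proof (rule ex1I[of _ "(x, y)"])
    show "?P (x, y)" unfolding fst_conv snd_conv iff using x y by blast
    fix c assume "?P c"
    then have c: "fst c > 0" "snd c > 0" "snd c powr (s + 1) = fst c powr r"
        "fst c powr - ?b + \<sigma> / fst c = 1"
      unfolding iff by blast+
    have "fst c = x"
      using equilibrium_strict_decreasing[OF b \<open>\<sigma> \<ge> 0\<close>, of "fst c" x]
        equilibrium_strict_decreasing[OF b \<open>\<sigma> \<ge> 0\<close>, of x "fst c"] c x
      by (cases "fst c" x rule: linorder_cases) auto
    moreover have "snd c = y"
    proof -
      have "snd c powr (s + 1) = y powr (s + 1)" using c y \<open>fst c = x\<close> by simp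
      then show ?thesis using c(2) y(1) \<open>s \<ge> 0\<close> 
        using powr_le_cancel2[of "s + 1" "snd c" y] powr_le_cancel2[of "s + 1" y "snd c"] by simp
    qed
    ultimately show "c = (x, y)" by (simp add: prod_eq_iff)
  qed
  from theI'[OF this] have "?P (us, vs)" using c unfolding constant_solution_def by simp
  then show "us > 0" "vs > 0" "vs powr (s + 1) = us powr r" "us powr - ?b + \<sigma> / us = 1"
    unfolding fst_conv snd_conv iff by blast+
qed

section \<open>Comparison with the constant solution\<close>

text \<open>
  Production divided by decay for each component; the equations become
  \<open>d1 \<Delta>u = u (1 - u_balance)\<close> and \<open>d2 \<Delta>v = v (1 - v_balance)\<close>.
\<close>

definition u_balance :: "real \<Rightarrow> real \<Rightarrow> real \<Rightarrow> real \<Rightarrow> real \<Rightarrow> real" where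
  "u_balance p q \<sigma> u v = u powr (p - 1) / v powr q + \<sigma> / u"

definition v_balance :: "real \<Rightarrow> real \<Rightarrow> real \<Rightarrow> real \<Rightarrow> real" where
  "v_balance r s u v = u powr r / v powr (s + 1)"

lemma reaction_eq_balance:
  fixes u v :: real
  assumes "u > 0" "v > 0"
  shows "u - u powr p / v powr q - \<sigma> = u * (1 - u_balance p q \<sigma> u v)"
    and "v - u powr r / v powr s = v * (1 - v_balance r s u v)"
  using assms by (simp_all add: u_balance_def v_balance_def powr_diff powr_add field_simps)

text \<open>
  At the minimum \<open>x\<close> of \<open>v / u\<^sup>B\<close>, with minimal value \<open>l\<close>, the function \<open>v - l u\<^sup>B\<close> is nonnegative and
  vanishes at \<open>x\<close>. As this function is linear in \<open>v\<close>, its Laplacian contains no gradient of \<open>v\<close>.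
  The sign \<open>c\<close> treats minima (\<open>c = 1\<close>, \<open>B \<ge> 1\<close>) and maxima (\<open>c = -1\<close>, \<open>B \<le> 1\<close>) together.
\<close>

lemma extremum_of_quotient:
  assumes dom: "bounded_smooth_domain n \<Omega>" and d: "d1 > 0" "d2 > 0"
    and sol: "positive_smooth_solution n \<Omega> d1 d2 p q r s \<sigma> u v"
    and B: "0 \<le> B" "0 \<le> c * (B - 1)"
    and x: "x \<in> closure \<Omega>" and pos: "\<And>y. y \<in> closure \<Omega> \<Longrightarrow> u y > 0 \<and> v y > 0"
    and ext: "\<And>y. y \<in> closure \<Omega> \<Longrightarrow> c * (v x / u x powr B) \<le> c * (v y / u y powr B)"
  shows "c * (B * (1 - u_balance p q \<sigma> (u x) (v x)) / d1) \<le> c * ((1 - v_balance r s (u x) (v x)) / d2)"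
proof -
  have ux: "u x > 0" and vx: "v x > 0" using pos x by auto
  define l where "l = v x / u x powr B"
  have l: "l > 0" using ux vx by (simp add: l_def)
  have ineq: "c * l * B * u x powr (B - 1) * ((u x - u x powr p / v x powr q - \<sigma>) / d1)
      + - c * ((v x - u x powr r / v x powr s) / d2) \<le> 0"
  proof (rule extremum_of_power_combination[OF dom d sol _ x])
    have "0 \<le> l * B" using B l by simp
    \<comment> \<open>The gradient term has the sign of \<open>c (B - 1)\<close>.\<close>
    from mult_nonneg_nonneg[OF this B(2)]
    show "0 \<le> c * l * B * (B - 1)" by (simp add: mult_ac)
    fix y assume y: "y \<in> closure \<Omega>"
    have "u y powr B > 0" using pos[OF y] by auto
    moreover have "c * l \<le> c * v y / u y powr B" using ext[OF y] by (simp add: l_def)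
    ultimately have "c * l * u y powr B \<le> c * v y" by (simp add: pos_le_divide_eq)
    moreover have "l * u x powr B = v x" using ux by (simp add: l_def)
    then have "c * l * u x powr B = c * v x" by (simp only: mult.assoc)
    ultimately show "c * l * u y powr B + - c * v y \<le> c * l * u x powr B + - c * v x" by linarith
  qed
  have "l * u x powr (B - 1) * u x = v x"
    using ux by (simp add: l_def powr_diff)
  then have eq: "c * l * B * u x powr (B - 1) * ((u x - u x powr p / v x powr q - \<sigma>) / d1)
      = v x * (c * (B * (1 - u_balance p q \<sigma> (u x) (v x)) / d1))"
    unfolding reaction_eq_balance(1)[OF ux vx] by (auto simp: algebra_simps)
  have "v x * (c * (B * (1 - u_balance p q \<sigma> (u x) (v x)) / d1))
      \<le> v x * (c * ((1 - v_balance r s (u x) (v x)) / d2))"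
    using ineq unfolding eq reaction_eq_balance(2)[OF ux vx] by (simp add: mult_ac)
  then show ?thesis by (rule mult_left_le_imp_le) (rule vx)
qed

lemma extremum_of_component:
  assumes dom: "bounded_smooth_domain n \<Omega>" and d: "d1 > 0" "d2 > 0"
    and sol: "positive_smooth_solution n \<Omega> d1 d2 p q r s \<sigma> u v"
    and x: "x \<in> closure \<Omega>" and pos: "\<And>y. y \<in> closure \<Omega> \<Longrightarrow> u y > 0 \<and> v y > 0"
  shows "(\<And>y. y \<in> closure \<Omega> \<Longrightarrow> c * u y \<le> c * u x) \<Longrightarrow> c * (1 - u_balance p q \<sigma> (u x) (v x)) \<le> 0"
    and "(\<And>y. y \<in> closure \<Omega> \<Longrightarrow> c * v y \<le> c * v x) \<Longrightarrow> c * (1 - v_balance r s (u x) (v x)) \<le> 0"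
proof -
  have ux: "u x > 0" and vx: "v x > 0" using pos x by auto
  have abs: "\<bar>u y\<bar> = u y" if "y \<in> closure \<Omega>" for y using pos[OF that] by simp
  show "c * (1 - u_balance p q \<sigma> (u x) (v x)) \<le> 0" if "\<And>y. y \<in> closure \<Omega> \<Longrightarrow> c * u y \<le> c * u x"
  proof -
    have "c * 1 * u x powr (1 - 1) * ((u x - u x powr p / v x powr q - \<sigma>) / d1)
        + 0 * ((v x - u x powr r / v x powr s) / d2) \<le> 0"
      by (rule extremum_of_power_combination[OF dom d sol _ x]) (use that abs x in auto)
    then have "(u x / d1) * (c * (1 - u_balance p q \<sigma> (u x) (v x))) \<le> 0"
      unfolding reaction_eq_balance(1)[OF ux vx] using ux by (simp add: mult_ac)
    moreover have "u x / d1 > 0" using ux d by simp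
    ultimately show ?thesis by (metis mult_pos_pos linorder_not_less)
  qed
  show "c * (1 - v_balance r s (u x) (v x)) \<le> 0" if "\<And>y. y \<in> closure \<Omega> \<Longrightarrow> c * v y \<le> c * v x"
  proof -
    have "0 * 1 * u x powr (1 - 1) * ((u x - u x powr p / v x powr q - \<sigma>) / d1)
        + c * ((v x - u x powr r / v x powr s) / d2) \<le> 0"
      by (rule extremum_of_power_combination[OF dom d sol _ x]) (use that in auto)
    then have "(v x / d2) * (c * (1 - v_balance r s (u x) (v x))) \<le> 0"
      unfolding reaction_eq_balance(2)[OF ux vx] by (simp add: mult_ac)
    moreover have "v x / d2 > 0" using vx d by simp
    ultimately show ?thesis by (metis mult_pos_pos linorder_not_less)
  qed
qed

text \<open>
  How the quotient changes when \<open>u\<close> is scaled by \<open>t\<close> and \<open>v / u\<^sup>B\<close> is kept; together with monotonicity in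
  \<open>v\<close> it compares the extremum of \<open>u\<close> with the extremum of \<open>v / u\<^sup>B\<close>.
\<close>

lemma v_balance_scaling:
  fixes U V t :: real
  assumes "U > 0" "V > 0" "t > 0"
  shows "v_balance r s (t * U) (t powr B * V) = v_balance r s U V * t powr - (B * (s + 1) - r)"
proof -
  have "t powr r / t powr (B * (s + 1)) = t powr - (B * (s + 1) - r)"
    by (simp flip: powr_diff)
  moreover have "v_balance r s (t * U) (t powr B * V)
      = v_balance r s U V * (t powr r / t powr (B * (s + 1)))"
    using assms by (simp add: v_balance_def powr_mult powr_powr mult_ac)
  ultimately show ?thesis by simp
qed

lemma v_balance_antimono:
  fixes u v w :: real
  assumes "0 < v" "v \<le> w" "s \<ge> 0"
  shows "v_balance r s u w \<le> v_balance r s u v"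
  unfolding v_balance_def using assms by (intro divide_left_mono powr_mono2) auto

text \<open>
  If the maximum \<open>U\<close> of \<open>u\<close> exceeds \<open>us\<close>, then at the minimum of \<open>v / u\<^sup>B\<close> the maximum principle bounds the
  excess \<open>v_balance - 1\<close> by \<open>B d2 / d1 \<le> 1\<close> times the excess \<open>u_balance - 1\<close>, whereas
  \<open>production_gap_above_equilibrium\<close> says that it is larger. The bound for \<open>v\<close> then follows from
  \<open>v\<^bsup>s+1\<^esup> \<le> u\<^sup>r\<close> at the maximum of \<open>v\<close>.
\<close>

lemma solution_le_constant:
  assumes q: "0 < q" "q < s + 1" and s: "0 \<le> s" and r: "0 < r" and \<sigma>: "0 \<le> \<sigma>"
    and b: "0 < q * r / (s + 1) - (p - 1)"
    and B: "1 \<le> B" "1 \<le> B * (s + 1) - r"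
      "q * r / (s + 1) - (p - 1) \<le> (B * (s + 1) - r) * (1 - q / (s + 1))"
    and dom: "bounded_smooth_domain n \<Omega>" and d: "d1 > 0" "d2 > 0" "B * (d2 / d1) \<le> 1"
    and c: "(us, vs) = constant_solution n \<Omega> d1 d2 p q r s \<sigma>"
    and sol: "positive_smooth_solution n \<Omega> d1 d2 p q r s \<sigma> u v"
    and x: "x \<in> closure \<Omega>"
  shows "u x \<le> us \<and> v x \<le> vs"
proof -
  let ?b = "q * r / (s + 1) - (p - 1)" and ?a = "q / (s + 1)" and ?e = "B * (s + 1) - r"
  note cs = constant_solution_eqns[OF s \<sigma> b dom c]
  note cl = positive_solution_on_closure[OF dom sol]
  note pos = cl(6)
  note comp = extremum_of_component[OF dom d(1,2) sol _ pos, where c = 1]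
  have u_le: "u y \<le> us" if y: "y \<in> closure \<Omega>" for y
  proof (rule ccontr)
    assume "\<not> u y \<le> us"
    obtain x0 where x0: "x0 \<in> closure \<Omega>" "\<And>z. z \<in> closure \<Omega> \<Longrightarrow> u z \<le> u x0"
      using continuous_attains_sup[OF cl(2,3,4)] by blast
    have "continuous_on (closure \<Omega>) (\<lambda>z. v z / u z powr B)"
      using pos by (intro continuous_intros cl) force+
    then obtain x1 where x1: "x1 \<in> closure \<Omega>"
      "\<And>z. z \<in> closure \<Omega> \<Longrightarrow> v x1 / u x1 powr B \<le> v z / u z powr B"
      using continuous_attains_inf[OF cl(2,3)] by blast
    define U V t where "U = u x0" and "V = v x0" and "t = u x1 / U"
    have UV: "U > 0" "V > 0" "u x1 > 0" "v x1 > 0" using pos x0 x1 by (auto simp: U_def V_def)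
    have Uus: "us < U" using x0(2)[OF y] \<open>\<not> u y \<le> us\<close> by (simp add: U_def)
    have t: "0 < t" "t \<le> 1" "u x1 = t * U" using UV x0(2)[OF x1(1)] by (auto simp: t_def U_def)
    have v1: "v x1 \<le> t powr B * V"
      using x1(2)[OF x0(1)] UV t(1) unfolding U_def[symmetric] V_def[symmetric] t(3)
      by (simp add: powr_mult field_simps)
    define X0 X where "X0 = v_balance r s U V" and "X = v_balance r s (u x1) (v x1)"
    have X0pos: "X0 > 0" using UV by (simp add: X0_def v_balance_def)
    have "1 \<le> u_balance p q \<sigma> U V"
      using comp(1)[OF x0(1)] x0(2) by (simp add: U_def V_def)
    then have bal0: "1 \<le> X0 powr ?a * U powr - ?b + \<sigma> / U"
      unfolding u_balance_def X0_def v_balance_def production_in_terms_of_quotient[OF UV(1,2) s, of p q r] .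
    have scal: "X0 * t powr - ?e \<le> X"
      unfolding X0_def v_balance_scaling[OF UV(1,2) t(1), symmetric] X_def t(3)[symmetric]
      by (rule v_balance_antimono[OF UV(4) v1 s])
    have above: "U powr - ?b + \<sigma> / U < 1"
      using equilibrium_strict_decreasing[OF b \<sigma> cs(1) Uus] cs(4) by simp
    have bal1: "u_balance p q \<sigma> (u x1) (v x1) = X powr ?a * (t * U) powr - ?b + \<sigma> / (t * U)"
      unfolding u_balance_def X_def v_balance_def production_in_terms_of_quotient[OF UV(3,4) s, of p q r]
      by (simp only: t(3))
    have "B * (1 - u_balance p q \<sigma> (u x1) (v x1)) / d1 \<le> (1 - X) / d2"
      using extremum_of_quotient[OF dom d(1,2) sol, of B 1 x1] pos x1 B(1) by (simp add: X_def)
    then have "X - 1 \<le> B * (d2 / d1) * (u_balance p q \<sigma> (u x1) (v x1) - 1)"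
      using d by (simp add: field_simps)
    moreover have "B * (d2 / d1) * (X powr ?a * (t * U) powr - ?b + \<sigma> / (t * U) - 1) < X - 1"
      by (rule production_gap_above_equilibrium[OF _ _ B(2,3) \<sigma> UV(1) t(1,2) above X0pos bal0 scal])
        (use q s d B(1) in auto)
    ultimately show False unfolding bal1 by linarith
  qed
  obtain y where y: "y \<in> closure \<Omega>" "\<And>z. z \<in> closure \<Omega> \<Longrightarrow> v z \<le> v y"
    using continuous_attains_sup[OF cl(2,3,5)] by blast
  have "1 \<le> v_balance r s (u y) (v y)" using comp(2)[OF y(1)] y(2) by simp
  then have "v y powr (s + 1) \<le> u y powr r"
    using pos[OF y(1)] by (simp add: v_balance_def pos_le_divide_eq)
  also have "\<dots> \<le> us powr r" using u_le[OF y(1)] pos[OF y(1)] r by (intro powr_mono2) auto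
  also have "\<dots> = vs powr (s + 1)" using cs(3) by simp
  finally have "v y \<le> vs" using cs(2) s by (intro powr_le_cancel2[of "s + 1" vs "v y"]) auto
  then show ?thesis using u_le[OF x] y(2)[OF x] by linarith
qed

text \<open>
  The mirror image with the minimum of \<open>u\<close> and the maximum of \<open>v / u\<close>. The comparison function \<open>v - l u\<^sup>B\<close>
  has to be handled at a maximum, which requires \<open>B \<le> 1\<close>, while \<open>B (s + 1) - r\<close> must be positive; the choice
  \<open>B = 1\<close> is possible because \<open>r < s + 1\<close>.
\<close>

lemma solution_ge_constant:
  assumes q: "0 < q" and s: "0 \<le> s" and r: "0 < r" "r < s + 1" and \<sigma>: "0 \<le> \<sigma>"
    and b: "0 < q * r / (s + 1) - (p - 1)"
    and m: "1 \<le> m" "q / (s + 1) + (q * r / (s + 1) - (p - 1)) / (s + 1 - r) \<le> m" "1 / (s + 1 - r) \<le> m"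
    and dom: "bounded_smooth_domain n \<Omega>" and d: "d1 > 0" "d2 > 0" "d2 / d1 * m \<le> 1"
    and c: "(us, vs) = constant_solution n \<Omega> d1 d2 p q r s \<sigma>"
    and sol: "positive_smooth_solution n \<Omega> d1 d2 p q r s \<sigma> u v"
    and x: "x \<in> closure \<Omega>"
  shows "us \<le> u x \<and> vs \<le> v x"
proof -
  let ?b = "q * r / (s + 1) - (p - 1)" and ?a = "q / (s + 1)" and ?e = "s + 1 - r"
  note cs = constant_solution_eqns[OF s \<sigma> b dom c]
  note cl = positive_solution_on_closure[OF dom sol]
  note pos = cl(6)
  note comp = extremum_of_component[OF dom d(1,2) sol _ pos, where c = "- 1"]
  have u_ge: "us \<le> u y" if y: "y \<in> closure \<Omega>" for y
  proof (rule ccontr)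
    assume "\<not> us \<le> u y"
    obtain x0 where x0: "x0 \<in> closure \<Omega>" "\<And>z. z \<in> closure \<Omega> \<Longrightarrow> u x0 \<le> u z"
      using continuous_attains_inf[OF cl(2,3,4)] by blast
    have "continuous_on (closure \<Omega>) (\<lambda>z. v z / u z powr 1)"
      using pos by (intro continuous_intros cl) force+
    then obtain x1 where x1: "x1 \<in> closure \<Omega>"
      "\<And>z. z \<in> closure \<Omega> \<Longrightarrow> v z / u z powr 1 \<le> v x1 / u x1 powr 1"
      using continuous_attains_sup[OF cl(2,3)] by blast
    define U V t where "U = u x0" and "V = v x0" and "t = u x1 / U"
    have UV: "U > 0" "V > 0" "u x1 > 0" "v x1 > 0" using pos x0 x1 by (auto simp: U_def V_def)
    have Uus: "U < us" using x0(2)[OF y] \<open>\<not> us \<le> u y\<close> by (simp add: U_def)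
    have t: "1 \<le> t" "u x1 = t * U" using UV x0(2)[OF x1(1)] by (auto simp: t_def U_def)
    then have t0: "0 < t" by simp
    have v1: "t powr 1 * V \<le> v x1"
      using x1(2)[OF x0(1)] UV t0 unfolding U_def[symmetric] V_def[symmetric] t(2)
      by (simp add: field_simps)
    define X0 X where "X0 = v_balance r s U V" and "X = v_balance r s (u x1) (v x1)"
    have X0pos: "X0 > 0" "X > 0" using UV by (simp_all add: X0_def X_def v_balance_def)
    have "u_balance p q \<sigma> U V \<le> 1"
      using comp(1)[OF x0(1)] x0(2) by (simp add: U_def V_def)
    then have bal0: "X0 powr ?a * U powr - ?b + \<sigma> / U \<le> 1"
      unfolding u_balance_def X0_def v_balance_def production_in_terms_of_quotient[OF UV(1,2) s, of p q r] .
    have "X \<le> X0 * t powr - (1 * (s + 1) - r)"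
      unfolding X0_def v_balance_scaling[OF UV(1,2) t0, symmetric] X_def t(2)[symmetric]
      by (rule v_balance_antimono[OF _ v1 s]) (use t0 UV in auto)
    then have scal: "X \<le> X0 * t powr - ?e" by simp
    have below: "1 < U powr - ?b + \<sigma> / U"
      using equilibrium_strict_decreasing[OF b \<sigma> UV(1) Uus] cs(4) by simp
    have bal1: "u_balance p q \<sigma> (u x1) (v x1) = X powr ?a * (t * U) powr - ?b + \<sigma> / (t * U)"
      unfolding u_balance_def X_def v_balance_def production_in_terms_of_quotient[OF UV(3,4) s, of p q r]
      by (simp only: t(2))
    have "- 1 * (1 * (1 - u_balance p q \<sigma> (u x1) (v x1)) / d1) \<le> - 1 * ((1 - X) / d2)"
      unfolding X_def
      by (rule extremum_of_quotient[OF dom d(1,2) sol _ _ x1(1) pos]) (use x1(2) in auto)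
    then have "1 - X \<le> d2 / d1 * (1 - u_balance p q \<sigma> (u x1) (v x1))"
      using d by (simp add: field_simps)
    moreover have "d2 / d1 * (1 - (X powr ?a * (t * U) powr - ?b + \<sigma> / (t * U))) < 1 - X"
      by (rule production_gap_below_equilibrium[OF _ b _ \<sigma> UV(1) t(1) m below X0pos(1) bal0 X0pos(2) scal])
        (use q s d r in auto)
    ultimately show False unfolding bal1 by linarith
  qed
  obtain y where y: "y \<in> closure \<Omega>" "\<And>z. z \<in> closure \<Omega> \<Longrightarrow> v y \<le> v z"
    using continuous_attains_inf[OF cl(2,3,5)] by blast
  have "v_balance r s (u y) (v y) \<le> 1" using comp(2)[OF y(1)] y(2) by simp
  then have "u y powr r \<le> v y powr (s + 1)"
    using pos[OF y(1)] by (simp add: v_balance_def pos_divide_le_eq)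
  moreover have "us powr r \<le> u y powr r" using u_ge[OF y(1)] cs(1) r by (intro powr_mono2) auto
  ultimately have "vs powr (s + 1) \<le> v y powr (s + 1)" using cs(3) by simp
  then have "vs \<le> v y" using pos[OF y(1)] s by (intro powr_le_cancel2[of "s + 1" "v y" vs]) auto
  then show ?thesis using u_ge[OF x] y(2)[OF x] by linarith
qed

section \<open>Choice of the diffusion thresholds\<close>

theorem theorem1p1:
  fixes p q r s \<sigma> :: real
  assumes "p \<ge> 0" "q \<ge> 0" "r \<ge> 0" "s \<ge> 0" "\<sigma> \<ge> 0"
    and "0 < (p - 1) / r" "(p - 1) / r < q / (s + 1)"
  shows "\<exists>k1 k2.
     (q < s + 1 \<longrightarrow> k1 > 0 \<and>
        (\<forall>(n::nat) \<Omega> (d1::real) (d2::real) u v us vs.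
           n \<ge> 1 \<and> bounded_smooth_domain n \<Omega> \<and> d1 > 0 \<and> d2 > 0 \<and>
           (us, vs) = constant_solution n \<Omega> d1 d2 p q r s \<sigma> \<and>
           d2 / d1 \<le> k1 \<and> positive_smooth_solution n \<Omega> d1 d2 p q r s \<sigma> u v \<longrightarrow>
           (\<forall>x \<in> Euclidean_space n closure_of \<Omega>. u x \<le> us \<and> v x \<le> vs))) \<and>
     (r < s + 1 \<longrightarrow> k2 > 0 \<and>
        (\<forall>(n::nat) \<Omega> (d1::real) (d2::real) u v us vs.
           n \<ge> 1 \<and> bounded_smooth_domain n \<Omega> \<and> d1 > 0 \<and> d2 > 0 \<and>
           (us, vs) = constant_solution n \<Omega> d1 d2 p q r s \<sigma> \<and>
           d2 / d1 \<le> k2 \<and> positive_smooth_solution n \<Omega> d1 d2 p q r s \<sigma> u v \<longrightarrow>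
           (\<forall>x \<in> Euclidean_space n closure_of \<Omega>. u x \<ge> us \<and> v x \<ge> vs))) \<and>
     (max q r < s + 1 \<longrightarrow>
        (\<forall>(n::nat) \<Omega> (d1::real) (d2::real) u v us vs.
           n \<ge> 1 \<and> bounded_smooth_domain n \<Omega> \<and> d1 > 0 \<and> d2 > 0 \<and>
           (us, vs) = constant_solution n \<Omega> d1 d2 p q r s \<sigma> \<and>
           d2 / d1 \<le> min k1 k2 \<and> positive_smooth_solution n \<Omega> d1 d2 p q r s \<sigma> u v \<longrightarrow>
           (\<forall>x \<in> Euclidean_space n closure_of \<Omega>. u x = us \<and> v x = vs)))"
proof -
  let ?b = "q * r / (s + 1) - (p - 1)" and ?a = "q / (s + 1)"
  have r: "r > 0" using \<open>r \<ge> 0\<close> \<open>0 < (p - 1) / r\<close> by (cases "r = 0") auto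
  have "0 < q / (s + 1)" using assms(6,7) by linarith
  then have q: "q > 0" using \<open>s \<ge> 0\<close> by (simp add: zero_less_divide_iff)
  have b: "0 < ?b" using assms(7) r by (simp add: pos_divide_less_eq mult.commute)
  \<comment> \<open>\<open>e\<close> is the size that \<open>production_gap_above_equilibrium\<close> demands of \<open>B (s + 1) - r\<close>.\<close>
  define e where "e = max 1 (?b / (1 - ?a))"
  define B where "B = max 1 ((r + e) / (s + 1))"
  define m where "m = max 1 (max (?a + ?b / (s + 1 - r)) (1 / (s + 1 - r)))"
  have B1: "B \<ge> 1" and m1: "m \<ge> 1" by (auto simp: B_def m_def)
  have upper: "u x \<le> us \<and> v x \<le> vs"
    if "q < s + 1" "bounded_smooth_domain n \<Omega>" "d1 > 0" "d2 > 0"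
      "(us, vs) = constant_solution n \<Omega> d1 d2 p q r s \<sigma>" "d2 / d1 \<le> 1 / B"
      "positive_smooth_solution n \<Omega> d1 d2 p q r s \<sigma> u v" "x \<in> closure \<Omega>"
    for n \<Omega> d1 d2 u v us vs x
  proof (rule solution_le_constant[where B = B and u = u and v = v and x = x])
    have "(r + e) / (s + 1) \<le> B" by (simp add: B_def)
    then have Be: "e \<le> B * (s + 1) - r" using \<open>s \<ge> 0\<close> by (simp add: pos_divide_le_eq algebra_simps)
    moreover have "1 \<le> e" by (simp add: e_def)
    ultimately show "1 \<le> B * (s + 1) - r" by linarith
    have a1: "0 < 1 - ?a" using that(1) \<open>s \<ge> 0\<close> by simp
    have "?b / (1 - ?a) \<le> e" by (simp add: e_def)
    then have "?b / (1 - ?a) \<le> B * (s + 1) - r" using Be by linarith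
    then show "?b \<le> (B * (s + 1) - r) * (1 - ?a)" using a1 by (simp only: pos_divide_le_eq)
    show "B * (d2 / d1) \<le> 1" using that(6) B1 by (simp add: field_simps)
  qed (use that B1 q r b assms(4,5) in auto)
  have lower: "us \<le> u x \<and> vs \<le> v x"
    if "r < s + 1" "bounded_smooth_domain n \<Omega>" "d1 > 0" "d2 > 0"
      "(us, vs) = constant_solution n \<Omega> d1 d2 p q r s \<sigma>" "d2 / d1 \<le> 1 / m"
      "positive_smooth_solution n \<Omega> d1 d2 p q r s \<sigma> u v" "x \<in> closure \<Omega>"
    for n \<Omega> d1 d2 u v us vs x
  proof (rule solution_ge_constant[where m = m and u = u and v = v and x = x])
    show "?a + ?b / (s + 1 - r) \<le> m" "1 / (s + 1 - r) \<le> m" by (auto simp: m_def)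
    show "d2 / d1 * m \<le> 1" using that(6) m1 by (simp add: field_simps)
  qed (use that m1 q r b assms(4,5) in auto)
  have cl: "Euclidean_space n closure_of \<Omega> = closure \<Omega>" if "bounded_smooth_domain n \<Omega>" for n \<Omega>
    using that closure_of_Euclidean_space[of \<Omega> n]
    by (auto simp: bounded_smooth_domain_def openin_Euclidean_space_iff)
  let ?P = "\<lambda>k n \<Omega> d1 d2 u v us vs. (n::nat) \<ge> 1 \<and> bounded_smooth_domain n \<Omega> \<and> d1 > 0 \<and> d2 > 0 \<and>
    (us, vs) = constant_solution n \<Omega> d1 d2 p q r s \<sigma> \<and>
    d2 / d1 \<le> k \<and> positive_smooth_solution n \<Omega> d1 d2 p q r s \<sigma> u v"
  have le: "u x \<le> us" "v x \<le> vs"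
    if "q < s + 1" "?P (1 / B) n \<Omega> d1 d2 u v us vs" "x \<in> Euclidean_space n closure_of \<Omega>"
    for n \<Omega> d1 d2 u v us vs x
    using upper[of n \<Omega> d1 d2 us vs u v x] that cl[of n \<Omega>] by auto
  have ge: "us \<le> u x" "vs \<le> v x"
    if "r < s + 1" "?P (1 / m) n \<Omega> d1 d2 u v us vs" "x \<in> Euclidean_space n closure_of \<Omega>"
    for n \<Omega> d1 d2 u v us vs x
    using lower[of n \<Omega> d1 d2 us vs u v x] that cl[of n \<Omega>] by auto
  have eq: "u x = us" "v x = vs"
    if "max q r < s + 1" "?P (min (1 / B) (1 / m)) n \<Omega> d1 d2 u v us vs"
      "x \<in> Euclidean_space n closure_of \<Omega>"
    for n \<Omega> d1 d2 u v us vs x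
  proof -
    have qr: "q < s + 1" "r < s + 1" using that(1) by auto
    have P: "?P (1 / B) n \<Omega> d1 d2 u v us vs" "?P (1 / m) n \<Omega> d1 d2 u v us vs"
      using that(2) by auto
    show "u x = us"
      by (rule antisym[OF le(1)[OF qr(1) P(1) that(3)] ge(1)[OF qr(2) P(2) that(3)]])
    show "v x = vs"
      by (rule antisym[OF le(2)[OF qr(1) P(1) that(3)] ge(2)[OF qr(2) P(2) that(3)]])
  qed
  show ?thesis
  proof (rule exI[of _ "1 / B"], rule exI[of _ "1 / m"], intro conjI impI allI ballI)
    show "1 / B > 0" "1 / m > 0" using B1 m1 by auto
  qed ((rule le ge eq; assumption))+
qed

end
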